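(* Let $2\leq n\leq 7$. Every minimal complex generating $\mathsf{Mon}_n$ belongs to the $K_2$ family, the $K_5$ family, the $K_6$ family or the $K_7$ family.
   Context: For finite sets $A,I$, a language is a subset $L\subseteq A^I$. For finite sets $B,J$ and a function $f:B^J\to A^I$, the input window $\mathcal{W}_f(i)\subseteq J$ of $i\in I$ is the smallest $W\subseteq J$ such that for all $x,y\in B^J$ agreeing on $W$, $f(x)_i=f(y)_i$. The communication complex $K_f$ is the simplicial complex on vertex set $I$ whose simplices are the sets $S\subseteq I$ with $\bigcap_{i\in S}\mathcal{W}_f(i)\neq\emptyset$. A simplicial complex $K$ on $I$ generates $L$ if there exist finite sets $B,J$ and $f:B^J\to A^I$ with $f(B^J)=L$ and $K_f\subseteq K$; $K$ is minimal generating $L$ if it generates $L$ and no complex properly contained in $K$ generates $L$. $\mathsf{Mon}_n\subseteq\{0,1\}^n$ is the set of monotone (non-decreasing or non-increasing) binary strings of length $n$. Positions $I_n=\{0,\ldots,n-1\}$ are identified with $\mathbb{Z}/n\mathbb{Z}$; for $a,b\in\mathbb{Z}$, $[\![a,b]\!]=\{c\bmod n: a\leq c\leq b'\}$ where $b'\equiv b\pmod n$ and $a\leq b'<a+n$. $\langle S_0,\ldots,S_k\rangle$ denotes the complex whose maximal simplices are the $S_i$. Vertex insertion: for $i\in\{0,\ldots,n\}$ let $\rho^+_i:\{0,\ldots,n-1\}\to\{0,\ldots,n\}\setminus\{i\}$, $\rho^+_i(j)=j$ if $j<i$ and $j+1$ if $j\geq i$; for a complex $K$ on $I_n$, $\mathrm{ins}_i(K)$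 is the complex on $I_{n+1}$ generated by the sets $\rho^+_i(S)\cup\{i\}$ if $S$ contains $(i-1)\bmod n$ or $i\bmod n$, and $\rho^+_i(S)$ otherwise, for $S\in K$. The $K_2$ family: complexes $\langle I_n\setminus\{a\},I_n\setminus\{b\}\rangle$ with $a\neq b$. The $K_5$ family: for $n\geq5$, images under circular permutations $x\mapsto x+c\bmod n$ of $K^n_{i,j}=\langle[\![1,n-1]\!],[\![0,j-1]\!],[\![j+1,i-1]\!],[\![i+1,0]\!]\rangle$, $1<i<j<n-1$. $K_6=\langle[\![0,3]\!],[\![1,4]\!],[\![2,5]\!],[\![3,0]\!],[\![4,1]\!],[\![5,2]\!]\rangle$ on $I_6$ and $K_7=\langle[\![0,4]\!],[\![1,5]\!],[\![2,6]\!],[\![4,1]\!],[\![5,2]\!]\rangle$ on $I_7$; the $K_6$ (resp. $K_7$) family consists of complexes obtained from $K_6$ (resp. $K_7$) by finitely many vertex insertions and circular permutations. *)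

theory Defs
  imports Main "HOL-Library.FuncSet"
begin

text \<open>
  For finite sets \<open>A\<close>, \<open>I\<close>, the power \<open>A\<^sup>I\<close> is the set \<open>I \<rightarrow>\<^sub>E A\<close> of extensional functions, and a
  language over \<open>A\<close> with positions \<open>I\<close> is a subset of it.
\<close>

subsection \<open>Generation of languages\<close>

definition determines :: "'b set \<Rightarrow> 'j set \<Rightarrow> (('j \<Rightarrow> 'b) \<Rightarrow> ('i \<Rightarrow> 'a)) \<Rightarrow> 'i \<Rightarrow> 'j set \<Rightarrow> bool" where
  "determines B J f i W \<longleftrightarrow> W \<subseteq> J \<and>
     (\<forall>x \<in> J \<rightarrow>\<^sub>E B. \<forall>y \<in> J \<rightarrow>\<^sub>E B. (\<forall>j \<in> W. x j = y j) \<longrightarrow> f x i = f y i)"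

text \<open>\<open>Least\<close> is taken with respect to inclusion; the least element exists by
  \<open>determines_input_window\<close> and \<open>input_window_subset\<close> below.\<close>

definition input_window :: "'b set \<Rightarrow> 'j set \<Rightarrow> (('j \<Rightarrow> 'b) \<Rightarrow> ('i \<Rightarrow> 'a)) \<Rightarrow> 'i \<Rightarrow> 'j set" where
  "input_window B J f i = (LEAST W. determines B J f i W)"

lemma determinesD:
  assumes "determines B J f i W" and "x \<in> J \<rightarrow>\<^sub>E B" and "y \<in> J \<rightarrow>\<^sub>E B"
    and "\<And>j. j \<in> W \<Longrightarrow> x j = y j"
  shows "f x i = f y i"
  using assms unfolding determines_def by blast

lemma determines_subset: "determines B J f i W \<Longrightarrow> W \<subseteq> J"
  unfolding determines_def by (rule conjunct1)

lemma determines_Int: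
  assumes "determines B J f i V" and "determines B J f i W"
  shows "determines B J f i (V \<inter> W)"
  unfolding determines_def
proof (intro conjI ballI impI)
  show "V \<inter> W \<subseteq> J" using determines_subset[OF assms(1)] by blast
next
  fix x y assume x: "x \<in> J \<rightarrow>\<^sub>E B" and y: "y \<in> J \<rightarrow>\<^sub>E B" and eq: "\<forall>j \<in> V \<inter> W. x j = y j"
  define z where "z = (\<lambda>j. if j \<in> V then x j else y j)"
  have "V \<subseteq> J" by (rule determines_subset[OF assms(1)])
  then have z: "z \<in> J \<rightarrow>\<^sub>E B"
    using x y by (auto simp: z_def PiE_iff extensional_def)
  have "f x i = f z i"
    by (rule determinesD[OF assms(1) x z]) (simp add: z_def)
  moreover have "f z i = f y i"
    by (rule determinesD[OF assms(2) z y]) (use eq in \<open>simp add: z_def\<close>)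
  ultimately show "f x i = f y i" by simp
qed

lemma input_window_least:
  assumes "finite J"
  shows "determines B J f i (input_window B J f i) \<and>
    (\<forall>W. determines B J f i W \<longrightarrow> input_window B J f i \<subseteq> W)"
proof -
  let ?D = "{W. determines B J f i W}"
  have fin: "finite ?D"
    by (rule finite_subset[of _ "Pow J"]) (use assms in \<open>auto dest: determines_subset\<close>)
  have "determines B J f i J"
    unfolding determines_def
  proof (intro conjI ballI impI)
    fix x y assume "x \<in> J \<rightarrow>\<^sub>E B" "y \<in> J \<rightarrow>\<^sub>E B" "\<forall>j \<in> J. x j = y j"
    then have "x = y" by (intro PiE_ext[of x J "\<lambda>_. B" y]) auto
    then show "f x i = f y i" by simp
  qed simp
  then have ne: "?D \<noteq> {}" by auto
  have "finite F \<Longrightarrow> F \<noteq> {} \<Longrightarrow> F \<subseteq> ?D \<Longrightarrow> determines B J f i (\<Inter>F)" for F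
    by (induction F rule: finite_ne_induct) (auto intro: determines_Int)
  from this[OF fin ne] have D: "determines B J f i (\<Inter>?D)" by simp
  have "input_window B J f i = \<Inter>?D"
    unfolding input_window_def
    by (rule Least_equality) (use D in auto)
  then show ?thesis using D by auto
qed

lemmas determines_input_window = input_window_least[THEN conjunct1]
lemmas input_window_subset = input_window_least[THEN conjunct2, rule_format]

text \<open>The empty set is a simplex of every complex, but not every element of the vertex set \<open>I\<close> has to
  be a simplex: the communication complex omits the positions on which \<open>f\<close> is constant.\<close>

definition simplicial_complex_on :: "'i set \<Rightarrow> 'i set set \<Rightarrow> bool" where
  "simplicial_complex_on I K \<longleftrightarrow> K \<subseteq> Pow I \<and> {} \<in> K \<and> (\<forall>S \<in> K. \<forall>T. T \<subseteq> S \<longrightarrow> T \<in> K)"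

definition communication_complex ::
    "'i set \<Rightarrow> 'b set \<Rightarrow> 'j set \<Rightarrow> (('j \<Rightarrow> 'b) \<Rightarrow> ('i \<Rightarrow> 'a)) \<Rightarrow> 'i set set" where
  "communication_complex I B J f = {S. S \<subseteq> I \<and> (\<Inter>i \<in> S. input_window B J f i) \<noteq> {}}"

text \<open>Only the cardinalities of \<open>B\<close> and \<open>J\<close> matter, so that it is no restriction to take them among
  the finite sets of natural numbers. For \<open>L \<subseteq> (I \<rightarrow>\<^sub>E A)\<close>, the condition on the image makes \<open>f\<close> a
  map from \<open>J \<rightarrow>\<^sub>E B\<close> to \<open>I \<rightarrow>\<^sub>E A\<close>.\<close>

definition generates :: "'i set \<Rightarrow> 'i set set \<Rightarrow> ('i \<Rightarrow> 'a) set \<Rightarrow> bool" where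
  "generates I K L \<longleftrightarrow> simplicial_complex_on I K \<and>
     (\<exists>(B :: nat set) (J :: nat set) f. finite B \<and> finite J \<and>
        f ` (J \<rightarrow>\<^sub>E B) = L \<and> communication_complex I B J f \<subseteq> K)"

definition minimal_generating :: "'i set \<Rightarrow> 'i set set \<Rightarrow> ('i \<Rightarrow> 'a) set \<Rightarrow> bool" where
  "minimal_generating I K L \<longleftrightarrow> generates I K L \<and> (\<forall>K'. K' \<subset> K \<longrightarrow> \<not> generates I K' L)"

subsection \<open>Monotone binary strings\<close>

text \<open>Positions are integers, so that arithmetic modulo \<open>n\<close> needs no truncated subtraction.\<close>

definition positions :: "nat \<Rightarrow> int set" where
  "positions n = {0..<int n}"

definition Mon :: "nat \<Rightarrow> (int \<Rightarrow> nat) set" where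
  "Mon n = {x \<in> positions n \<rightarrow>\<^sub>E {0, 1}. mono_on (positions n) x \<or> antimono_on (positions n) x}"

subsection \<open>The families of complexes\<close>

text \<open>\<open>arc n a b\<close> is \<open>\<lbrakk>a, b\<rbrakk>\<close>.\<close>

definition arc :: "nat \<Rightarrow> int \<Rightarrow> int \<Rightarrow> int set" where
  "arc n a b = {c mod int n | c b'. b' mod int n = b mod int n \<and> a \<le> b' \<and> b' < a + int n \<and>
                                    a \<le> c \<and> c \<le> b'}"

text \<open>\<open>complex_of F\<close> is the complex generated by \<open>F\<close>. Its maximal simplices are exactly the elements
  of \<open>F\<close> when these are pairwise incomparable, as in the definitions of the families below.\<close>

definition complex_of :: "'i set set \<Rightarrow> 'i set set" where
  "complex_of F = {T. \<exists>S \<in> F. T \<subseteq> S}"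

definition circ_perm :: "nat \<Rightarrow> int \<Rightarrow> int set set \<Rightarrow> int set set" where
  "circ_perm n c K = (\<lambda>S. (\<lambda>x. (x + c) mod int n) ` S) ` K"

definition rho_plus :: "int \<Rightarrow> int \<Rightarrow> int" where
  "rho_plus i j = (if j < i then j else j + 1)"

definition ins :: "nat \<Rightarrow> int \<Rightarrow> int set set \<Rightarrow> int set set" where
  "ins n i K = complex_of
     ((\<lambda>S. if (i - 1) mod int n \<in> S \<or> i mod int n \<in> S
           then rho_plus i ` S \<union> {i} else rho_plus i ` S) ` K)"

definition K2_family :: "nat \<Rightarrow> int set set set" where
  "K2_family n = {complex_of {positions n - {a}, positions n - {b}} | a b.
                    a \<in> positions n \<and> b \<in> positions n \<and> a \<noteq> b}"

definition K5 :: "nat \<Rightarrow> int \<Rightarrow> int \<Rightarrow> int set set" where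
  "K5 n i j = complex_of {arc n 1 (int n - 1), arc n 0 (j - 1), arc n (j + 1) (i - 1), arc n (i + 1) 0}"

definition K5_family :: "nat \<Rightarrow> int set set set" where
  "K5_family n = {circ_perm n c (K5 n i j) | c i j. n \<ge> 5 \<and> 1 < i \<and> i < j \<and> j < int n - 1}"

definition K6 :: "int set set" where
  "K6 = complex_of {arc 6 0 3, arc 6 1 4, arc 6 2 5, arc 6 3 0, arc 6 4 1, arc 6 5 2}"

definition K7 :: "int set set" where
  "K7 = complex_of {arc 7 0 4, arc 7 1 5, arc 7 2 6, arc 7 4 1, arc 7 5 2}"

text \<open>\<open>obtained m K\<^sub>0 n K\<close>: the complex \<open>K\<close> on \<open>positions n\<close> is obtained from the complex \<open>K\<^sub>0\<close> on
  \<open>positions m\<close> by finitely many vertex insertions and circular permutations.\<close>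

inductive obtained :: "nat \<Rightarrow> int set set \<Rightarrow> nat \<Rightarrow> int set set \<Rightarrow> bool"
  for m :: nat and K0 :: "int set set" where
  start: "obtained m K0 m K0"
| insertion: "obtained m K0 n K \<Longrightarrow> 0 \<le> i \<Longrightarrow> i \<le> int n \<Longrightarrow> obtained m K0 (Suc n) (ins n i K)"
| permutation: "obtained m K0 n K \<Longrightarrow> obtained m K0 n (circ_perm n c K)"

definition K6_family :: "nat \<Rightarrow> int set set set" where
  "K6_family n = {K. obtained 6 K6 n K}"

definition K7_family :: "nat \<Rightarrow> int set set set" where
  "K7_family n = {K. obtained 7 K7 n K}"

end

theory Submission
  imports Defs "HOL-Library.Countable"
begin

text \<open>
  A monotone string is a point of the circle \<open>\<int>/2n\<close>: extended to all integers by
  \<open>x (i + n) = \<not> x i\<close>, it has one jump per period. Changing an input that misses the positions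
  \<open>M \<noteq> {}\<close> cannot move the jump out of its gap of \<open>M\<close>, so every input can be split into one copy for
  each gap. Hence the maximal simplices of a minimal complex are complements of cyclic intervals, and
  the complex is determined by the intervals that its simplices can miss.

  Two obstructions remain. If every input misses a vertex \<open>v\<close> or one of two edges (pairs of adjacent
  positions), a jump at one edge with bit \<open>v\<close> set can be mixed with a jump at the other edge with bit
  \<open>v\<close> cleared. If every input misses one of the four edges of a path or one further edge, three
  strings with suitable jumps can be mixed into two inputs that differ only where \<open>v\<^sub>5\<close> does not look,
  but force different bits at \<open>v\<^sub>5\<close>. An interval structure escaping both obstructions contains a
  member of the \<open>K\<^sub>2\<close>, \<open>K\<^sub>5\<close> or \<open>K\<^sub>7\<close> family, all of which generate, or is exactly a member of
  the \<open>K\<^sub>6\<close> family; in the last case it is not needed that the latter generates.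
\<close>

subsection \<open>Monotone strings as points of a circle\<close>

text \<open>The string of the point \<open>p\<close> of \<open>\<int>/2n\<close>, which jumps between \<open>p - 1\<close> and \<open>p\<close>.\<close>

definition cyc :: "nat \<Rightarrow> int \<Rightarrow> int \<Rightarrow> bool" where
  "cyc n p i \<longleftrightarrow> odd ((i - p) div int n)"

lemma cyc_antiperiodic:
  assumes "0 < n"
  shows "cyc n p (i + int n * k) \<longleftrightarrow> cyc n p i \<noteq> odd k"
proof -
  have "(i + int n * k - p) div int n = k + (i - p) div int n"
    using assms by (metis add.commute add_diff_eq diff_add_eq div_mult_self2 of_nat_0_less_iff less_irrefl)
  then show ?thesis by (auto simp: cyc_def)
qed

lemma cyc_add: "0 < n \<Longrightarrow> cyc n p (i + int n) \<longleftrightarrow> \<not> cyc n p i"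
  using cyc_antiperiodic[of n p i 1] by simp

lemma cyc_mod: "0 < n \<Longrightarrow> cyc n p i \<longleftrightarrow> cyc n p (i mod int n) \<noteq> odd (i div int n)"
  using cyc_antiperiodic[of n p "i mod int n" "i div int n"] by simp

lemma cyc_shift: "cyc n (p + c) (i + c) = cyc n p i"
  by (simp add: cyc_def)

text \<open>Over a stretch of length at most \<open>n\<close> the quotient that defines
  \<open>cyc\<close> is monotone and rises by at most 1. Equal parities at the two ends therefore
  force equal quotients, also in between.\<close>

lemma cyc_between:
  assumes "0 < n" and "i \<le> j" and "j \<le> k" and "k \<le> i + int n"
    and "cyc n p i = cyc n p k"
  shows "cyc n p j = cyc n p i"
proof -
  have "(i - p) div int n \<le> (j - p) div int n" "(j - p) div int n \<le> (k - p) div int n"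
    using assms by (auto intro: zdiv_mono1)
  moreover have "(k - p) div int n \<le> (i - p + int n) div int n"
    using assms by (intro zdiv_mono1) auto
  moreover have "(i - p + int n) div int n = (i - p) div int n + 1"
    using assms by simp
  ultimately have "(k - p) div int n = (i - p) div int n \<or> (k - p) div int n = (i - p) div int n + 1"
    by linarith
  moreover have "(k - p) div int n \<noteq> (i - p) div int n + 1"
    using assms(5) by (auto simp: cyc_def)
  ultimately show ?thesis
    using \<open>(i - p) div int n \<le> (j - p) div int n\<close> \<open>(j - p) div int n \<le> (k - p) div int n\<close>
    by (simp add: cyc_def)
qed

lemma cyc_self: "0 < n \<Longrightarrow> \<not> cyc n p p"
  by (simp add: cyc_def)

lemma cyc_before: "0 < n \<Longrightarrow> cyc n (p + 1) p"
  using cyc_add[of n "p + 1" p] by (simp add: cyc_def div_pos_pos_trivial)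

lemma cyc_cong_mod:
  assumes "0 < n"
  shows "cyc n (p mod (2 * int n)) = cyc n p"
proof
  fix i
  have "cyc n p i = cyc n (p mod (2 * int n)) (i - 2 * int n * (p div (2 * int n)))"
    using cyc_shift[of n "p mod (2 * int n)" "2 * int n * (p div (2 * int n))" "i - 2 * int n * (p div (2 * int n))"]
    by simp
  also have "\<dots> = cyc n (p mod (2 * int n)) i"
    using cyc_antiperiodic[OF assms, of "p mod (2 * int n)" i "- 2 * (p div (2 * int n))"]
    by (simp add: algebra_simps)
  finally show "cyc n (p mod (2 * int n)) i = cyc n p i" by simp
qed

text \<open>The points 0 to \<open>n - 1\<close> are the strings of \<open>p\<close> ones followed
  by zeros, and the points \<open>n\<close> to \<open>2n - 1\<close> are their negations; the two
  constant strings are the points 0 and \<open>n\<close>.\<close>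

lemma cyc_positions:
  assumes "i \<in> positions n" and "0 \<le> p" "p < 2 * int n"
  shows "cyc n p i \<longleftrightarrow> (if p < int n then i < p else p - int n \<le> i)"
proof -
  have i: "0 \<le> i" "i < int n" using assms by (auto simp: positions_def)
  consider "p \<le> i" | "i < p" "p - int n \<le> i" | "i < p - int n" by linarith
  then show ?thesis
  proof cases
    case 1
    then have "(i - p) div int n = 0" using i assms by (intro div_pos_pos_trivial) auto
    then show ?thesis using 1 i by (simp add: cyc_def)
  next
    case 2
    then have "(i - p + int n) div int n = 0" using i assms by (intro div_pos_pos_trivial) auto
    then have "(i - p) div int n = -1" using i by simp
    then show ?thesis using 2 i by (simp add: cyc_def)
  next
    case 3
    then have "(i - p + 2 * int n) div int n = 0" using i assms by (intro div_pos_pos_trivial) auto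
    moreover have "(i - p + 2 * int n) div int n = (i - p) div int n + 2" 
      using i by (metis add.commute div_mult_self3 le_less_trans less_irrefl)
    ultimately have "(i - p) div int n = -2" by simp
    then show ?thesis using 3 i by (simp add: cyc_def)
  qed
qed

text \<open>A non-decreasing string whose first one is at \<open>m\<close> is the point
  \<open>n + m\<close>, a non-increasing one whose last one is at \<open>m\<close> is the point
  \<open>m + 1\<close>, and the zero string is the point 0. The converse reads off the direction of
  the step from \<open>cyc_positions\<close>.\<close>

lemma Mon_iff_cyc:
  assumes "0 < n"
  shows "y \<in> Mon n \<longleftrightarrow> y \<in> positions n \<rightarrow>\<^sub>E {0, 1} \<and> (\<exists>p. \<forall>i \<in> positions n. (y i = 1) = cyc n p i)"
    (is "_ \<longleftrightarrow> ?E \<and> ?P")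
proof (cases ?E)
  case E: True
  then have y01: "y i = 0 \<or> y i = 1" if "i \<in> positions n" for i using that by (auto simp: PiE_iff)
  show ?thesis
  proof
    assume M: "y \<in> Mon n"
    let ?A = "{i \<in> positions n. y i = 1}"
    have "finite (positions n)" by (simp add: positions_def)
    then have fin: "finite ?A" by simp
    have 0: "0 \<in> positions n" using assms by (simp add: positions_def)
    from M consider (mono) "mono_on (positions n) y" | (anti) "antimono_on (positions n) y"
      by (auto simp: Mon_def)
    then show "?E \<and> ?P"
    proof cases
      case mono
      show ?thesis
      proof (cases "?A = {}")
        case True
        then have "\<forall>i \<in> positions n. (y i = 1) = cyc n 0 i"
          using assms by (auto simp: cyc_positions positions_def)
        then show ?thesis using E by blast
      next
        case False
        define m where "m = Min ?A"
        have mA: "m \<in> ?A" unfolding m_def using fin False by (intro Min_in) auto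
        have "(y i = 1) = cyc n (int n + m) i" if i: "i \<in> positions n" for i
        proof -
          have "y i = 1 \<longleftrightarrow> m \<le> i"
          proof
            assume "y i = 1" then show "m \<le> i" unfolding m_def using fin i by (intro Min_le) auto
          next
            assume "m \<le> i"
            then have "y m \<le> y i" using mono mA i by (auto simp: monotone_on_def)
            then show "y i = 1" using mA y01[OF i] by auto
          qed
          moreover have "cyc n (int n + m) i \<longleftrightarrow> m \<le> i"
            using mA i by (subst cyc_positions) (auto simp: positions_def)
          ultimately show ?thesis by simp
        qed
        then show ?thesis using E by blast
      qed
    next
      case anti
      show ?thesis
      proof (cases "?A = {}")
        case True
        then have "\<forall>i \<in> positions n. (y i = 1) = cyc n 0 i"
          using assms by (auto simp: cyc_positions positions_def)
        then show ?thesis using E by blast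
      next
        case False
        define m where "m = Max ?A"
        have mA: "m \<in> ?A" unfolding m_def using fin False by (intro Max_in) auto
        have "(y i = 1) = cyc n (m + 1) i" if i: "i \<in> positions n" for i
        proof -
          have "y i = 1 \<longleftrightarrow> i \<le> m"
          proof
            assume "y i = 1" then show "i \<le> m" unfolding m_def using fin i by (intro Max_ge) auto
          next
            assume "i \<le> m"
            then have "y m \<le> y i" using monotone_onD[OF anti i, of m] mA by blast
            then show "y i = 1" using mA y01[OF i] by auto
          qed
          moreover have "cyc n (m + 1) i \<longleftrightarrow> i \<le> m"
            using mA i by (subst cyc_positions) (auto simp: positions_def)
          ultimately show ?thesis by simp
        qed
        then show ?thesis using E by blast
      qed
    qed
  next
    assume "?E \<and> ?P"
    then obtain p where "\<forall>i \<in> positions n. (y i = 1) = cyc n p i" by blast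
    then have p: "(y i = 1) = cyc n (p mod (2 * int n)) i" if "i \<in> positions n" for i
      using that assms by (simp add: cyc_cong_mod)
    define q where "q = p mod (2 * int n)"
    have q: "0 \<le> q" "q < 2 * int n" using assms by (auto simp: q_def)
    have yq: "(y i = 1) = (if q < int n then i < q else q - int n \<le> i)" if "i \<in> positions n" for i
      using p[OF that] cyc_positions[OF that q] by (simp add: q_def)
    have "mono_on (positions n) y \<or> antimono_on (positions n) y"
    proof (cases "q < int n")
      case True
      have "antimono_on (positions n) y"
      proof (rule monotone_onI)
        fix i k assume ik: "i \<in> positions n" "k \<in> positions n" "i \<le> k"
        then show "y k \<le> y i" using yq[of i] yq[of k] y01[of i] y01[of k] True by auto
      qed
      then show ?thesis ..
    next
      case False
      have "mono_on (positions n) y"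
      proof (rule monotone_onI)
        fix i k assume ik: "i \<in> positions n" "k \<in> positions n" "i \<le> k"
        then show "y i \<le> y k" using yq[of i] yq[of k] y01[of i] y01[of k] False by auto
      qed
      then show ?thesis ..
    qed
    then show "y \<in> Mon n" using E by (simp add: Mon_def)
  qed
qed (simp add: Mon_def)

subsection \<open>Maps onto the monotone strings\<close>

text \<open>\<open>dep i\<close> may be larger than the input window of \<open>i\<close>.\<close>

definition mon_map :: "nat \<Rightarrow> (('j \<Rightarrow> nat) \<Rightarrow> int \<Rightarrow> bool) \<Rightarrow> (int \<Rightarrow> 'j set) \<Rightarrow> bool" where
  "mon_map n F dep \<longleftrightarrow>
     (\<forall>x. \<exists>p. \<forall>i. F x i = cyc n p i) \<and>
     (\<forall>p. \<exists>x. \<forall>i. F x i = cyc n p i) \<and>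
     (\<forall>x y i. (\<forall>j \<in> dep i. x j = y j) \<longrightarrow> F x i = F y i)"

lemma mon_map_cyc: "mon_map n F dep \<Longrightarrow> \<exists>p. \<forall>i. F x i = cyc n p i"
  by (simp add: mon_map_def)

lemma mon_map_surj: "mon_map n F dep \<Longrightarrow> \<exists>x. \<forall>i. F x i = cyc n p i"
  by (simp add: mon_map_def)

lemma mon_map_dep: "mon_map n F dep \<Longrightarrow> (\<And>j. j \<in> dep i \<Longrightarrow> x j = y j) \<Longrightarrow> F x i = F y i"
  by (simp add: mon_map_def)

section \<open>Passing between generating maps and maps onto the circle\<close>

lemma mod_in_positions: "0 < n \<Longrightarrow> i mod int n \<in> positions n"
  by (simp add: positions_def)

lemma positions_mod: "i \<in> positions n \<Longrightarrow> i mod int n = i"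
  by (simp add: positions_def)

text \<open>Extending the outputs antiperiodically and admitting arbitrary inputs frees the later
  arguments from wrap-around at \<open>n\<close> and from extensionality.\<close>

lemma generates_mon_map:
  assumes n: "0 < n" and gen: "generates (positions n) K (Mon n)"
  obtains F and dep :: "int \<Rightarrow> nat set" and J
  where "mon_map n F dep" and "finite J" and "\<And>i. dep i \<subseteq> J" and "\<And>i. dep (i mod int n) = dep i"
    and "\<And>j. {i \<in> positions n. j \<in> dep i} \<in> K"
proof -
  from gen obtain B J :: "nat set" and f
    where fin: "finite B" "finite J" and im: "f ` (J \<rightarrow>\<^sub>E B) = Mon n"
      and KK: "communication_complex (positions n) B J f \<subseteq> K" and sc: "simplicial_complex_on (positions n) K"
    unfolding generates_def by auto
  obtain z0 where z0: "z0 \<in> J \<rightarrow>\<^sub>E B"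
  proof -
    have "(\<lambda>i. if i \<in> positions n then 0 else undefined) \<in> Mon n"
      by (auto simp: Mon_def monotone_on_def)
    then show ?thesis using im that by blast
  qed
  \<comment> \<open>Letters outside \<open>B\<close> are replaced by those of a fixed legal point.
    The replacement acts on each coordinate separately, so it does not enlarge any window.\<close>
  define r where "r x = (\<lambda>j. if j \<in> J then (if x j \<in> B then x j else z0 j) else undefined)" for x
  have r: "r x \<in> J \<rightarrow>\<^sub>E B" for x using z0 by (auto simp: r_def PiE_iff extensional_def)
  have rid: "r x = x" if "x \<in> J \<rightarrow>\<^sub>E B" for x
    using that by (auto simp: r_def PiE_iff extensional_def fun_eq_iff)
  define F where "F x i \<longleftrightarrow> (f (r x) (i mod int n) = 1) \<noteq> odd (i div int n)" for x i
  define dep where "dep i = input_window B J f (i mod int n)" for i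
  have "mon_map n F dep"
    unfolding mon_map_def
  proof (intro conjI allI impI)
    fix x
    have "f (r x) \<in> Mon n" using im r by blast
    then have "\<exists>p. \<forall>i \<in> positions n. (f (r x) i = 1) = cyc n p i" by (simp only: Mon_iff_cyc[OF n])
    then obtain p where "\<forall>i \<in> positions n. (f (r x) i = 1) = cyc n p i" ..
    then have "F x i = cyc n p i" for i
      unfolding F_def cyc_mod[OF n, of p i] using n by (metis mod_in_positions)
    then have "\<forall>i. F x i = cyc n p i" ..
    then show "\<exists>p. \<forall>i. F x i = cyc n p i" ..
  next
    fix p
    define y :: "int \<Rightarrow> nat" where "y = restrict (\<lambda>i. of_bool (cyc n p i)) (positions n)"
    have "y \<in> Mon n" unfolding Mon_iff_cyc[OF n] by (intro conjI exI[of _ p]) (simp_all add: y_def)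
    then have "y \<in> f ` (J \<rightarrow>\<^sub>E B)" by (simp only: im)
    then obtain x where x: "x \<in> J \<rightarrow>\<^sub>E B" "f x = y" by auto
    then have "F x i = cyc n p i" for i
      unfolding F_def cyc_mod[OF n, of p i] rid[OF x(1)] x(2)
      using n by (simp add: y_def mod_in_positions)
    then have "\<forall>i. F x i = cyc n p i" ..
    then show "\<exists>x. \<forall>i. F x i = cyc n p i" by (rule exI[of _ x])
  next
    fix x y :: "nat \<Rightarrow> nat" and i assume eq: "\<forall>j \<in> dep i. x j = y j"
    have det: "determines B J f (i mod int n) (dep i)"
      unfolding dep_def by (rule determines_input_window[OF fin(2)])
    then have "f (r x) (i mod int n) = f (r y) (i mod int n)"
      by (rule determinesD[OF _ r r]) (use eq in \<open>auto simp: r_def\<close>)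
    then show "F x i = F y i" by (simp add: F_def)
  qed
  moreover have "dep i \<subseteq> J" for i
    unfolding dep_def by (rule determines_subset[OF determines_input_window[OF fin(2)]])
  moreover have "{i \<in> positions n. j \<in> dep i} \<in> K" for j
  proof -
    have "j \<in> (\<Inter>i \<in> {i \<in> positions n. j \<in> dep i}. input_window B J f i)"
      by (auto simp: dep_def positions_mod)
    then have "{i \<in> positions n. j \<in> dep i} \<in> communication_complex (positions n) B J f"
      unfolding communication_complex_def by auto
    with KK show ?thesis ..
  qed
  ultimately show ?thesis using that[of F dep J] fin by (simp add: dep_def)
qed

lemma generatesI:
  fixes F :: "('j::countable \<Rightarrow> nat) \<Rightarrow> int \<Rightarrow> bool"
  assumes n: "0 < n" and sc: "simplicial_complex_on (positions n) K" and J: "finite J"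
    and cyc: "\<And>x. \<exists>p. \<forall>i \<in> positions n. F x i = cyc n p i"
    and surj: "\<And>p. 0 \<le> p \<Longrightarrow> p < 2 * int n \<Longrightarrow> \<exists>x. \<forall>i \<in> positions n. F x i = cyc n p i"
    and dep: "\<And>x y i. i \<in> positions n \<Longrightarrow> (\<And>j. j \<in> dep i \<Longrightarrow> x j = y j) \<Longrightarrow> F x i = F y i"
    and depJ: "\<And>i. i \<in> positions n \<Longrightarrow> dep i \<subseteq> J"
    and K: "\<And>j. j \<in> J \<Longrightarrow> {i \<in> positions n. j \<in> dep i} \<in> K"
  shows "generates (positions n) K (Mon n)"
proof -
  have "\<forall>p \<in> {0..<2 * int n}. \<exists>x. \<forall>i \<in> positions n. F x i = cyc n p i" using surj by auto
  then obtain X where X: "\<And>p i. p \<in> {0..<2 * int n} \<Longrightarrow> i \<in> positions n \<Longrightarrow> F (X p) i = cyc n p i"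
    by metis
  \<comment> \<open>Finitely many letters suffice: those used by one chosen preimage of each of the
    \<open>2n\<close> points.\<close>
  define B where "B = (\<Union>p \<in> {0..<2 * int n}. X p ` J)"
  define J' where "J' = to_nat ` J"
  define r :: "(nat \<Rightarrow> nat) \<Rightarrow> 'j \<Rightarrow> nat" where "r z = (\<lambda>j. z (to_nat j))" for z
  define f where "f z = restrict (\<lambda>i. of_bool (F (r z) i) :: nat) (positions n)" for z
  have "finite B" "finite J'" using J by (auto simp: B_def J'_def)
  moreover have "f ` (J' \<rightarrow>\<^sub>E B) = Mon n"
  proof
    show "f ` (J' \<rightarrow>\<^sub>E B) \<subseteq> Mon n"
    proof (intro image_subsetI)
      fix z
      from cyc[of "r z"] obtain p where "\<forall>i \<in> positions n. F (r z) i = cyc n p i" ..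
      then show "f z \<in> Mon n"
        unfolding Mon_iff_cyc[OF n] by (intro conjI exI[of _ p]) (simp_all add: f_def)
    qed
    show "Mon n \<subseteq> f ` (J' \<rightarrow>\<^sub>E B)"
    proof
      fix y assume "y \<in> Mon n"
      then have y: "y \<in> positions n \<rightarrow>\<^sub>E {0, 1}" and "\<exists>p. \<forall>i \<in> positions n. (y i = 1) = cyc n p i"
        unfolding Mon_iff_cyc[OF n] by simp_all
      from this(2) obtain p where p: "\<forall>i \<in> positions n. (y i = 1) = cyc n p i" ..
      define q where "q = p mod (2 * int n)"
      have q: "q \<in> {0..<2 * int n}" using n by (auto simp: q_def)
      define z where "z = restrict (\<lambda>k. X q (from_nat k)) J'"
      have z: "z \<in> J' \<rightarrow>\<^sub>E B" using q by (auto simp: z_def B_def J'_def)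
      have "f z i = y i" if i: "i \<in> positions n" for i
      proof -
        have "F (r z) i = F (X q) i"
          by (rule dep[OF i]) (use depJ[OF i] in \<open>auto simp: r_def z_def J'_def\<close>)
        also have "\<dots> = cyc n p i" using X[OF q i] cyc_cong_mod[OF n] by (simp add: q_def)
        finally show ?thesis using p y i by (auto simp: f_def PiE_iff)
      qed
      moreover have "f z i = y i" if "i \<notin> positions n" for i
        using that y by (auto simp: f_def PiE_iff extensional_def)
      ultimately have "f z = y" by blast
      then show "y \<in> f ` (J' \<rightarrow>\<^sub>E B)" using z by blast
    qed
  qed
  moreover have "communication_complex (positions n) B J' f \<subseteq> K"
  proof
    fix S assume S: "S \<in> communication_complex (positions n) B J' f"
    show "S \<in> K"
    proof (cases "S = {}")
      case True
      then show ?thesis using sc by (simp add: simplicial_complex_on_def)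
    next
      case False
      have win: "input_window B J' f i \<subseteq> to_nat ` dep i" if i: "i \<in> positions n" for i
      proof (rule input_window_subset)
        show "finite J'" by fact
        show "determines B J' f i (to_nat ` dep i)"
          unfolding determines_def
        proof (intro conjI ballI impI)
          show "to_nat ` dep i \<subseteq> J'" using depJ[OF i] by (auto simp: J'_def)
          fix x y :: "nat \<Rightarrow> nat" assume "\<forall>j \<in> to_nat ` dep i. x j = y j"
          then have "F (r x) i = F (r y) i" by (intro dep[OF i]) (auto simp: r_def)
          then show "f x i = f y i" by (simp add: f_def)
        qed
      qed
      from S obtain k where S': "S \<subseteq> positions n" and k: "\<And>i. i \<in> S \<Longrightarrow> k \<in> input_window B J' f i"
        by (auto simp: communication_complex_def)
      have sub: "k \<in> to_nat ` dep i" if "i \<in> S" for i using win k S' that by blast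
      with False obtain j where j: "k = to_nat j" and "j \<in> J" using depJ S' by blast
      have "S \<subseteq> {i \<in> positions n. j \<in> dep i}" using sub S' j by (auto simp: inj_image_mem_iff)
      then show ?thesis using K[OF \<open>j \<in> J\<close>] sc unfolding simplicial_complex_on_def by blast
    qed
  qed
  ultimately show ?thesis unfolding generates_def using sc by blast
qed

text \<open>Rotating the positions by \<open>c\<close> moves the point \<open>p\<close> to
  \<open>p + c\<close>; the antiperiodic extension supplies the negation of the bits carried past
  the end.\<close>

lemma generates_circ_perm:
  assumes n: "0 < n" and gen: "generates (positions n) K (Mon n)"
  shows "generates (positions n) (circ_perm n c K) (Mon n)"
proof -
  obtain F and dep :: "int \<Rightarrow> nat set" and J where F: "mon_map n F dep" and J: "finite J" "\<And>i. dep i \<subseteq> J"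
    and per: "\<And>i. dep (i mod int n) = dep i" and K: "\<And>j. {i \<in> positions n. j \<in> dep i} \<in> K"
    by (rule generates_mon_map[OF n gen]) blast
  have sc: "simplicial_complex_on (positions n) K" using gen by (simp add: generates_def)
  let ?r = "\<lambda>x. (x + c) mod int n"
  have rinv: "?r ((x - c) mod int n) = x" if "x \<in> positions n" for x
    using that by (simp add: mod_add_left_eq positions_mod)
  show ?thesis
  proof (rule generatesI[where F = "\<lambda>x i. F x (i - c)" and dep = "\<lambda>i. dep (i - c)", OF n _ J(1)])
    show "simplicial_complex_on (positions n) (circ_perm n c K)"
      unfolding simplicial_complex_on_def
    proof (intro conjI ballI allI impI)
      show "circ_perm n c K \<subseteq> Pow (positions n)" using n by (auto simp: circ_perm_def mod_in_positions)
      show "{} \<in> circ_perm n c K" using sc by (auto simp: circ_perm_def simplicial_complex_on_def)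
      fix S T assume "S \<in> circ_perm n c K" "T \<subseteq> S"
      then obtain U where U: "U \<in> K" "T \<subseteq> ?r ` U" by (auto simp: circ_perm_def)
      then obtain V where "V \<subseteq> U" "T = ?r ` V" by (auto simp: subset_image_iff)
      moreover have "V \<in> K" using \<open>V \<subseteq> U\<close> U sc by (auto simp: simplicial_complex_on_def)
      ultimately show "T \<in> circ_perm n c K" by (auto simp: circ_perm_def)
    qed
    fix x
    from mon_map_cyc[OF F] obtain p where "\<forall>i. F x i = cyc n p i" ..
    then have "\<forall>i \<in> positions n. F x (i - c) = cyc n (p + c) i"
      using cyc_shift[of n p c "_ - c"] by simp
    then show "\<exists>p. \<forall>i \<in> positions n. F x (i - c) = cyc n p i" ..
  next
    fix p
    from mon_map_surj[OF F] obtain x where "\<forall>i. F x i = cyc n (p - c) i" ..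
    then have "\<forall>i \<in> positions n. F x (i - c) = cyc n p i"
      using cyc_shift[of n "p - c" c "_ - c"] by simp
    then show "\<exists>x. \<forall>i \<in> positions n. F x (i - c) = cyc n p i" by (rule exI[of _ x])
  next
    fix j
    have "{i \<in> positions n. j \<in> dep (i - c)} = ?r ` {i \<in> positions n. j \<in> dep i}"
    proof (intro equalityI subsetI)
      fix i assume i: "i \<in> {i \<in> positions n. j \<in> dep (i - c)}"
      then have "i = ?r ((i - c) mod int n)" "(i - c) mod int n \<in> positions n" "j \<in> dep ((i - c) mod int n)"
        using n rinv per by (auto simp: mod_in_positions)
      then show "i \<in> ?r ` {i \<in> positions n. j \<in> dep i}" by blast
    next
      fix i assume "i \<in> ?r ` {i \<in> positions n. j \<in> dep i}"
      then obtain k where k: "k \<in> positions n" "j \<in> dep k" "i = ?r k" by blast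
      have "(i - c) mod int n = k" using k by (simp add: mod_diff_left_eq positions_mod)
      then have "dep (i - c) = dep k" using per[of "i - c"] by simp
      then show "i \<in> {i \<in> positions n. j \<in> dep (i - c)}" using k n by (simp add: mod_in_positions)
    qed
    then show "{i \<in> positions n. j \<in> dep (i - c)} \<in> circ_perm n c K"
      using K[of j] by (auto simp: circ_perm_def)
  next
    fix x y :: "nat \<Rightarrow> nat" and i assume "\<And>j. j \<in> dep (i - c) \<Longrightarrow> x j = y j"
    then show "F x (i - c) = F y (i - c)" by (rule mon_map_dep[OF F])
  qed (rule J(2))
qed

subsection \<open>Splitting the inputs into arcs\<close>

text \<open>Names each gap of \<open>M\<close> by the element of \<open>M\<close> at its left end;
  an element of \<open>M\<close> carries its own name. The label selects the copy of a split input
  that position \<open>i\<close> reads.\<close>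

definition prev_label :: "nat \<Rightarrow> int set \<Rightarrow> int \<Rightarrow> int" where
  "prev_label n M i = (i - int (LEAST d. (i - int d) mod int n \<in> M)) mod int n"

lemma prev_labelE:
  assumes "0 < n" and "M \<subseteq> positions n" and "M \<noteq> {}"
  obtains b where "b \<le> i" and "b mod int n \<in> M" and "prev_label n M i = b mod int n"
    and "\<And>j. b < j \<Longrightarrow> j \<le> i \<Longrightarrow> j mod int n \<notin> M"
proof -
  obtain m where "m \<in> M" using assms(3) by auto
  then have m: "m \<in> M" "m mod int n = m" using assms(2) positions_mod by auto
  let ?P = "\<lambda>d. (i - int d) mod int n \<in> M"
  have "(i - int (nat ((i - m) mod int n))) mod int n = m"
  proof -
    have "(i - int (nat ((i - m) mod int n))) mod int n = (i - (i - m)) mod int n"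
      using assms(1) by (simp add: mod_diff_right_eq)
    then show ?thesis using m by simp
  qed
  then have P: "?P (nat ((i - m) mod int n))" using m by simp
  show ?thesis
  proof (rule that[of "i - int (LEAST d. ?P d)"])
    show "(i - int (LEAST d. ?P d)) mod int n \<in> M" using P by (rule LeastI)
    show "j mod int n \<notin> M" if j: "i - int (LEAST d. ?P d) < j" "j \<le> i" for j
    proof
      assume "j mod int n \<in> M"
      then have "?P (nat (i - j))" using j by simp
      then have "(LEAST d. ?P d) \<le> nat (i - j)" by (rule Least_le)
      then show False using j by linarith
    qed
  qed (simp_all add: prev_label_def)
qed

lemma prev_label_eq:
  assumes "0 < n" and "b \<le> i" and "b mod int n \<in> M"
    and "\<And>j. b < j \<Longrightarrow> j \<le> i \<Longrightarrow> j mod int n \<notin> M"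
  shows "prev_label n M i = b mod int n"
proof -
  have "(LEAST d. (i - int d) mod int n \<in> M) = nat (i - b)"
  proof (rule Least_equality)
    show "(i - int (nat (i - b))) mod int n \<in> M" using assms by simp
    fix d assume "(i - int d) mod int n \<in> M"
    then show "nat (i - b) \<le> d" using assms(4)[of "i - int d"] by linarith
  qed
  then show ?thesis using assms(2) by (simp add: prev_label_def)
qed

lemma prev_label_cong:
  assumes "i mod int n = j mod int n"
  shows "prev_label n M i = prev_label n M j"
proof -
  have "(i - c) mod int n = (j - c) mod int n" for c using assms by (metis mod_diff_left_eq)
  then show ?thesis by (simp add: prev_label_def)
qed

lemma nextE:
  fixes i :: int
  assumes "0 < n" and "M \<subseteq> positions n" and "M \<noteq> {}"
  obtains a where "i < a" and "a mod int n \<in> M"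
    and "\<And>j. i < j \<Longrightarrow> j < a \<Longrightarrow> j mod int n \<notin> M"
proof -
  obtain m where "m \<in> M" using assms(3) by auto
  then have m: "m \<in> M" "m mod int n = m" using assms(2) positions_mod by auto
  let ?P = "\<lambda>d. (i + 1 + int d) mod int n \<in> M"
  have "(i + 1 + int (nat ((m - i - 1) mod int n))) mod int n = m"
  proof -
    have "(i + 1 + int (nat ((m - i - 1) mod int n))) mod int n = (i + 1 + (m - i - 1)) mod int n"
      using assms(1) by (simp add: mod_add_right_eq)
    then show ?thesis using m by simp
  qed
  then have P: "?P (nat ((m - i - 1) mod int n))" using m by simp
  show ?thesis
  proof (rule that[of "i + 1 + int (LEAST d. ?P d)"])
    show "(i + 1 + int (LEAST d. ?P d)) mod int n \<in> M" using P by (rule LeastI)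
    show "j mod int n \<notin> M" if j: "i < j" "j < i + 1 + int (LEAST d. ?P d)" for j
    proof
      assume "j mod int n \<in> M"
      then have "?P (nat (j - i - 1))" using j by simp
      then have "(LEAST d. ?P d) \<le> nat (j - i - 1)" by (rule Least_le)
      then show False using j by linarith
    qed
  qed simp
qed

text \<open>The common values on \<open>M\<close> already fix the gap of \<open>M\<close> in which the strings \<open>G k\<close> jump, so that
  only one of the labels is relevant.\<close>

lemma cyc_glue:
  assumes n: "0 < n" and M: "M \<subseteq> positions n" "M \<noteq> {}"
    and G: "\<And>k. \<exists>p. \<forall>i. G k i = cyc n p i"
    and agree: "\<And>k k' i. i mod int n \<in> M \<Longrightarrow> G k i = G k' i"
  shows "\<exists>k. \<forall>i. G (prev_label n M i) i = G k i"
proof -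
  obtain m where "m \<in> M" using M(2) by auto
  then have m: "m \<in> M" "m mod int n = m" using M(1) positions_mod by auto
  have between: "G k j = G k i" if "i \<le> j" "j \<le> l" "l \<le> i + int n" "G k i = G k l" for i j l k
  proof -
    from G obtain p where "\<forall>i. G k i = cyc n p i" ..
    then show ?thesis using cyc_between[OF n that(1-3), of p] that(4) by simp
  qed
  have anti: "G k (i + int n * t) = (G k i \<noteq> odd t)" for k i t
  proof -
    from G obtain p where "\<forall>i. G k i = cyc n p i" ..
    then show ?thesis using cyc_antiperiodic[OF n] by simp
  qed
  \<comment> \<open>\<open>M\<close> is traversed once, starting from \<open>m\<close>; on
    \<open>M\<close> all \<open>G k\<close> agree, so \<open>G 0\<close> represents them. The last
    element \<open>p\<close> that still shows the value at \<open>m\<close> opens the only gap of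
    \<open>M\<close> that can contain the jump.\<close>
  define W where "W = {i. m \<le> i \<and> i < m + int n \<and> i mod int n \<in> M \<and> G 0 i = G 0 m}"
  have "finite W" by (rule finite_subset[of _ "{m..<m + int n}"]) (auto simp: W_def)
  moreover have "m \<in> W" using m n by (simp add: W_def)
  ultimately have pW: "Max W \<in> W" and pmax: "\<And>i. i \<in> W \<Longrightarrow> i \<le> Max W" by (auto intro: Max_in)
  define p where "p = Max W"
  have p: "m \<le> p" "p < m + int n" "p mod int n \<in> M" "G 0 p = G 0 m"
    using pW by (simp_all add: W_def p_def)
  have Gm: "G k m = G 0 m" "G k p = G 0 m" for k
    using agree[of m k 0] agree[of p k 0] p m by simp_all
  have base: "G (prev_label n M i) i = G (p mod int n) i" if i: "m \<le> i" "i < m + int n" for i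
  proof (cases "i \<le> p")
    case True
    have "G k i = G 0 m" for k
      using between[of m i p k] True i p Gm by simp
    then show ?thesis by simp
  next
    case False
    show ?thesis
    proof (cases "\<exists>q. p < q \<and> q \<le> i \<and> q mod int n \<in> M")
      case True
      then obtain q where q: "p < q" "q \<le> i" "q mod int n \<in> M" by auto
      \<comment> \<open>Past a further element of \<open>M\<close> the jump has already happened:
        \<open>q\<close> carries the negated value, as does \<open>m + n\<close>, so every
        \<open>G k\<close> is constant from \<open>q\<close> to \<open>i\<close>.\<close>
      have "q \<notin> W" using pmax[of q] q by (force simp: p_def)
      then have "G 0 q \<noteq> G 0 m" using q i p by (simp add: W_def)
      then have q_ne: "G k q \<noteq> G 0 m" for k using agree[OF q(3), of k 0] by simp
      have m_ne: "G k (m + int n) \<noteq> G 0 m" for k using anti[of k m 1] Gm by simp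
      have "G k i = G k q" for k
        using between[of q i "m + int n" k] q i p q_ne[of k] m_ne[of k] by simp
      then show ?thesis using q_ne by simp
    next
      case none: False
      have "prev_label n M i = p mod int n"
        by (rule prev_label_eq) (use n False p none in auto)
      then show ?thesis by simp
    qed
  qed
  have "G (prev_label n M i) i = G (p mod int n) i" for i
  proof -
    define j where "j = m + (i - m) mod int n"
    have ij: "i = j + int n * ((i - m) div int n)" by (simp add: j_def)
    have "prev_label n M i = prev_label n M j" by (rule prev_label_cong) (subst ij, simp)
    moreover have "G (prev_label n M j) j = G (p mod int n) j"
      by (rule base) (use n in \<open>auto simp: j_def\<close>)
    ultimately show ?thesis
      using anti[of _ j "(i - m) div int n", folded ij] by simp
  qed
  then have "\<forall>i. G (prev_label n M i) i = G (p mod int n) i" ..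
  then show ?thesis ..
qed

definition block :: "nat \<Rightarrow> int \<Rightarrow> int \<Rightarrow> int set" where
  "block n a l = {i \<in> positions n. (i - a) mod int n < l}"

text \<open>Simplices are described by the cyclic intervals of length \<open>l\<close> that they miss.\<close>

definition avoidable :: "nat \<Rightarrow> int set set \<Rightarrow> int \<Rightarrow> int \<Rightarrow> bool" where
  "avoidable n K a l \<longleftrightarrow> 1 \<le> l \<and> l \<le> int n \<and> positions n - block n a l \<in> K"

text \<open>Every input is split into one copy for each gap between consecutive positions that it does not
  influence.\<close>

lemma generates_split:
  assumes n: "0 < n" and gen: "generates (positions n) K (Mon n)" and ne: "positions n \<notin> K"
  obtains F and dep :: "int \<Rightarrow> (nat \<times> int) set" and J
  where "mon_map n F dep" and "finite J" and "\<And>i. dep i \<subseteq> J"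
    and "\<And>j. \<exists>a l. avoidable n K a l \<and> (\<forall>i. (i - a) mod int n < l \<longrightarrow> j \<notin> dep i)"
proof -
  obtain F0 and dep0 :: "int \<Rightarrow> nat set" and J0 where F0: "mon_map n F0 dep0"
    and J0: "finite J0" "\<And>i. dep0 i \<subseteq> J0"
    and per: "\<And>i. dep0 (i mod int n) = dep0 i" and K: "\<And>j. {i \<in> positions n. j \<in> dep0 i} \<in> K"
    by (rule generates_mon_map[OF n gen]) blast
  have sc: "simplicial_complex_on (positions n) K" using gen by (simp add: generates_def)
  have down: "T \<in> K" if "S \<in> K" "T \<subseteq> S" for S T using sc that by (auto simp: simplicial_complex_on_def)
  define M where "M j = {i \<in> positions n. j \<notin> dep0 i}" for j
  have M: "M j \<subseteq> positions n" "M j \<noteq> {}" for j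
  proof -
    show "M j \<subseteq> positions n" by (auto simp: M_def)
    have "{i \<in> positions n. j \<in> dep0 i} \<noteq> positions n" using K[of j] ne by auto
    then show "M j \<noteq> {}" by (auto simp: M_def)
  qed
  have M_iff: "i mod int n \<in> M j \<longleftrightarrow> j \<notin> dep0 i" for i j
    using per n by (simp add: M_def mod_in_positions)
  define L where "L j = prev_label n (M j)" for j
  \<comment> \<open>Of each input \<open>j\<close>, position \<open>i\<close> uses only the copy
    named by the gap around \<open>i\<close> between positions that do not read
    \<open>j\<close>.\<close>
  define F where "F x i = F0 (\<lambda>j. x (j, L j i)) i" for x i
  define dep where "dep i = (\<lambda>j. (j, L j i)) ` dep0 i" for i
  \<comment> \<open>Inputs are split one after the other, unsplit ones using copy 0. The strings
    \<open>G k\<close> that use copy \<open>k\<close> of the next input everywhere agree where this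
    input is not read, so \<open>cyc_glue\<close> applies.\<close>
  have split: "\<exists>p. \<forall>i. F0 (\<lambda>j. if j \<in> A then x (j, L j i) else x (j, 0)) i = cyc n p i"
    if "finite A" for A x
    using that
  proof (induction A arbitrary: x rule: finite_induct)
    case empty
    then show ?case using mon_map_cyc[OF F0] by simp
  next
    case (insert j0 A)
    define G where "G k i = F0 (\<lambda>j. if j = j0 then x (j0, k) else if j \<in> A then x (j, L j i) else x (j, 0)) i"
      for k i
    have G: "\<exists>p. \<forall>i. G k i = cyc n p i" for k
    proof -
      define x' where "x' = (\<lambda>(j, k'). if j = j0 then x (j0, k) else x (j, k'))"
      have "(\<lambda>j. if j \<in> A then x' (j, L j i) else x' (j, 0)) =
          (\<lambda>j. if j = j0 then x (j0, k) else if j \<in> A then x (j, L j i) else x (j, 0))" for i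
        by (auto simp: x'_def fun_eq_iff)
      then show ?thesis using insert.IH[of x'] by (simp add: G_def)
    qed
    have agree: "G k i = G k' i" if "i mod int n \<in> M j0" for k k' i
      unfolding G_def by (rule mon_map_dep[OF F0]) (use that M_iff in auto)
    have "\<exists>k. \<forall>i. G (L j0 i) i = G k i"
      unfolding L_def by (rule cyc_glue[OF n M G agree])
    then obtain k where k: "\<And>i. G (L j0 i) i = G k i" by auto
    have "(\<lambda>j. if j \<in> insert j0 A then x (j, L j i) else x (j, 0)) =
        (\<lambda>j. if j = j0 then x (j0, L j0 i) else if j \<in> A then x (j, L j i) else x (j, 0))" for i
      by (auto simp: fun_eq_iff)
    then show ?case using G[of k] k by (simp add: G_def)
  qed
  have "mon_map n F dep"
    unfolding mon_map_def
  proof (intro conjI allI impI)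
    fix x
    have "F x i = F0 (\<lambda>j. if j \<in> J0 then x (j, L j i) else x (j, 0)) i" for i
      unfolding F_def by (rule mon_map_dep[OF F0]) (use J0 in auto)
    then show "\<exists>p. \<forall>i. F x i = cyc n p i" using split[OF J0(1), of x] by simp
  next
    fix p
    from mon_map_surj[OF F0, of p] obtain x where x: "\<forall>i. F0 x i = cyc n p i" ..
    show "\<exists>x. \<forall>i. F x i = cyc n p i"
      by (rule exI[of _ "\<lambda>(j, k). x j"]) (simp add: F_def x)
  next
    fix x y :: "nat \<times> int \<Rightarrow> nat" and i assume "\<forall>j \<in> dep i. x j = y j"
    then show "F x i = F y i"
      unfolding F_def by (intro mon_map_dep[OF F0]) (auto simp: dep_def)
  qed
  moreover have Lpos: "L j i \<in> positions n" for i j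
    using n by (simp add: L_def prev_label_def mod_in_positions)
  have "dep i \<subseteq> J0 \<times> positions n" for i
    using J0 Lpos by (auto simp: dep_def)
  moreover have "finite (J0 \<times> positions n)" using J0 by (simp add: positions_def)
  moreover have "\<exists>a l. avoidable n K a l \<and> (\<forall>i. (i - a) mod int n < l \<longrightarrow> jk \<notin> dep i)" for jk
  proof (cases "\<exists>i. jk \<in> dep i")
    case False
    \<comment> \<open>A copy that is read nowhere misses the whole circle.\<close>
    have "positions n - block n 0 (int n) = {}" using n by (auto simp: block_def positions_def)
    then show ?thesis using False n sc
      by (intro exI[of _ 0] exI[of _ "int n"]) (auto simp: avoidable_def simplicial_complex_on_def)
  next
    case True
    then obtain i0 where i0: "jk \<in> dep i0" ..
    obtain j k where jk: "jk = (j, k)" by (cases jk)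
    have j0: "j \<in> dep0 i0" and k: "k = L j i0" using i0 by (auto simp: jk dep_def)
    obtain b where b: "b \<le> i0" "b mod int n \<in> M j" "L j i0 = b mod int n"
      "\<And>i. b < i \<Longrightarrow> i \<le> i0 \<Longrightarrow> i mod int n \<notin> M j"
      unfolding L_def using prev_labelE[OF n M, of i0 j] by blast
    obtain a where a: "i0 < a" "a mod int n \<in> M j"
      "\<And>i. i0 < i \<Longrightarrow> i < a \<Longrightarrow> i mod int n \<notin> M j"
      using nextE[OF n M, of i0 j] by blast
    have gap: "i mod int n \<notin> M j" if "b < i" "i < a" for i
      using a(3)[of i] b(4)[of i] that by linarith
    have "a \<le> b + int n" using gap[of "b + int n"] b(2) n by force
    \<comment> \<open>The copy is read only strictly between \<open>b\<close> and \<open>a\<close>,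
      hence missed from \<open>a\<close> to \<open>b + n\<close>, both ends included. If
      \<open>M j\<close> is a single point, then \<open>a = b + n\<close> and
      \<open>l = 1\<close>.\<close>
    define l where "l = b + int n + 1 - a"
    have l: "1 \<le> l" "l \<le> int n" using \<open>a \<le> b + int n\<close> a b by (auto simp: l_def)
    have "positions n - block n a l \<subseteq> {i \<in> positions n. j \<in> dep0 i}"
    proof
      fix i assume "i \<in> positions n - block n a l"
      then have i: "i \<in> positions n" "l \<le> (i - a) mod int n" by (auto simp: block_def)
      define i' where "i' = a - int n + (i - a) mod int n"
      have "i' mod int n = i mod int n"
        by (simp add: i'_def mod_simps)
      moreover have "(i - a) mod int n < int n" using n by simp
      then have "i' mod int n \<notin> M j" by (intro gap) (use i in \<open>auto simp: i'_def l_def\<close>)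
      ultimately show "i \<in> {i \<in> positions n. j \<in> dep0 i}" using i M_iff by simp
    qed
    then have "positions n - block n a l \<in> K" using down K by blast
    moreover have "jk \<notin> dep i" if i: "(i - a) mod int n < l" for i
    proof
      assume "jk \<in> dep i"
      then have ji: "j \<in> dep0 i" and ki: "k = L j i" by (auto simp: jk dep_def)
      define i' where "i' = a + (i - a) mod int n"
      have ii: "i' mod int n = i mod int n" by (simp add: i'_def mod_simps)
      have "0 \<le> (i - a) mod int n" using n by simp
      then have i': "a \<le> i'" "i' \<le> b + int n" using i by (auto simp: i'_def l_def)
      have "i' mod int n \<notin> M j" using ji ii M_iff by simp
      then have "i' < b + int n" using i' b(2) by (cases "i' = b + int n") auto
      \<comment> \<open>Were the copy read at \<open>i'\<close>, its label would come from an
        element \<open>c\<close> of \<open>M j\<close> with \<open>a \<le> c < b + n\<close>, which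
        is not congruent to \<open>b\<close> because \<open>b < a\<close>.\<close>
      obtain c where c: "c \<le> i'" "c mod int n \<in> M j" "L j i' = c mod int n"
        "\<And>i. c < i \<Longrightarrow> i \<le> i' \<Longrightarrow> i mod int n \<notin> M j"
        unfolding L_def using prev_labelE[OF n M, of i' j] by blast
      have "a \<le> c" using c(4)[of a] a(2) i' by linarith
      have "L j i' = L j i" unfolding L_def by (rule prev_label_cong[OF ii])
      then have "c mod int n = b mod int n" using c(3) ki k b(3) by simp
      then have "int n dvd c - b" by (simp add: mod_eq_dvd_iff)
      moreover have "0 < c - b" "c - b < int n"
        using \<open>a \<le> c\<close> a b \<open>i' < b + int n\<close> c(1) by auto
      ultimately show False by (simp add: zdvd_not_zless)
    qed
    ultimately show ?thesis using l unfolding avoidable_def by blast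
  qed
  ultimately show ?thesis using that[of F dep "J0 \<times> positions n"] by blast
qed

subsection \<open>Obstructions\<close>

lemma mon_map_between:
  assumes "0 < n" and "mon_map n F dep" and "i \<le> j" "j \<le> k" "k \<le> i + int n" and "F x i = F x k"
  shows "F x j = F x i"
proof -
  from mon_map_cyc[OF assms(2)] obtain p where "\<forall>i. F x i = cyc n p i" ..
  then show ?thesis using cyc_between[OF assms(1,3-5), of p] assms(6) by simp
qed

lemma mon_map_add:
  assumes "0 < n" and "mon_map n F dep"
  shows "F x (i + int n) \<longleftrightarrow> \<not> F x i"
proof -
  from mon_map_cyc[OF assms(2)] obtain p where "\<forall>i. F x i = cyc n p i" ..
  then show ?thesis using cyc_add[OF assms(1), of p] by simp
qed

text \<open>At \<open>p + n\<close> the value at \<open>p\<close> is negated and so equals the value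
  at \<open>q\<close>, which leaves no room for a second change in between.\<close>

lemma mon_map_after_break:
  assumes "0 < n" and "mon_map n F dep" and "F x p \<noteq> F x q" and "q \<le> i" "i \<le> p + int n"
    and "p < q"
  shows "F x i = F x q"
  using mon_map_between[OF assms(1,2), of q i "p + int n" x] mon_map_add[OF assms(1,2), of x p] assms
  by auto

lemma mon_map_break:
  assumes n: "0 < n" and F: "mon_map n F dep"
  obtains x where "F x p \<longleftrightarrow> u" and "\<And>i. p < i \<Longrightarrow> i \<le> p + int n \<Longrightarrow> F x i \<longleftrightarrow> \<not> u"
proof -
  \<comment> \<open>Adding \<open>n\<close> to the point negates the string, which provides either
    direction of the jump.\<close>
  define q where "q = (if u then p + 1 else p + 1 + int n)"
  from mon_map_surj[OF F, of q] obtain x where x: "\<forall>i. F x i = cyc n q i" ..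
  have "cyc n (p + 1 + int n) i \<longleftrightarrow> \<not> cyc n (p + 1) i" for i
    using cyc_shift[of n "p + 1" "int n" "i - int n"] cyc_add[OF n, of "p + 1" "i - int n"] by simp
  then have q: "cyc n q i \<longleftrightarrow> cyc n (p + 1) i = u" for i by (simp add: q_def)
  have px: "F x p \<longleftrightarrow> u" "F x (p + 1) \<longleftrightarrow> \<not> u"
    using x q cyc_self[OF n, of "p + 1"] cyc_before[OF n, of p] by simp_all
  show ?thesis
  proof (rule that[OF px(1)])
    fix i assume "p < i" "i \<le> p + int n"
    then show "F x i \<longleftrightarrow> \<not> u"
      using mon_map_after_break[OF n F, of x p "p + 1" i] px by simp
  qed
qed

text \<open>A jump at \<open>p\<close> survives every change of the inputs that miss \<open>p\<close> and \<open>p + 1\<close>, and it determines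
  the bit at \<open>v\<close>; two jumps imposing opposite values at \<open>v\<close> are mixed.\<close>

lemma no_mon_map_vertex:
  assumes n: "0 < n" and F: "mon_map n F dep"
    and pq: "p < v" "v \<le> p + int n" "q < v" "v \<le> q + int n"
    and miss: "\<And>j. j \<notin> dep v \<or> j \<notin> dep p \<and> j \<notin> dep (p + 1) \<or> j \<notin> dep q \<and> j \<notin> dep (q + 1)"
  shows False
proof -
  obtain x where x: "F x p" "\<not> F x (p + 1)" by (rule mon_map_break[OF n F, of p True]) (use n in auto)
  obtain y where y: "\<not> F y q" "F y (q + 1)" by (rule mon_map_break[OF n F, of q False]) (use n in auto)
  \<comment> \<open>\<open>w\<close> keeps the jump of \<open>x\<close>, since it takes
    \<open>y\<close> only on inputs missing the edge at \<open>p\<close>. \<open>w'\<close> keeps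
    the jump of \<open>y\<close>, since by \<open>miss\<close> the inputs it takes from
    \<open>x\<close> miss the edge at \<open>q\<close>. On \<open>dep v\<close> the two
    coincide.\<close>
  define T where "T j \<longleftrightarrow> j \<in> dep v \<and> j \<notin> dep p \<and> j \<notin> dep (p + 1)" for j
  define w where "w j = (if T j then y j else x j)" for j
  define w' where "w' j = (if j \<in> dep v \<and> \<not> T j then x j else y j)" for j
  have "F w p = F x p" "F w (p + 1) = F x (p + 1)"
    by (auto intro!: mon_map_dep[OF F] simp: w_def T_def)
  then have "\<not> F w v" using mon_map_after_break[OF n F, of w p "p + 1" v] x pq by simp
  moreover have w'y: "w' j = y j" if "j \<in> dep q \<or> j \<in> dep (q + 1)" for j
    using miss[of j] that by (auto simp: w'_def T_def)
  have "F w' q = F y q" "F w' (q + 1) = F y (q + 1)"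
    by (auto intro!: mon_map_dep[OF F] simp: w'y)
  then have "F w' v" using mon_map_after_break[OF n F, of w' q "q + 1" v] y pq by simp
  moreover have "F w v = F w' v" by (rule mon_map_dep[OF F]) (auto simp: w_def w'_def)
  ultimately show False by simp
qed

text \<open>\<open>X\<close>, \<open>Y\<close>, \<open>Z\<close> jump between \<open>v0\<close> and \<open>v1\<close>, \<open>v5\<close> and \<open>v6\<close>, \<open>v3\<close> and \<open>v4\<close>. The mixture \<open>w\<close> jumps
  between \<open>v1\<close> and \<open>v2\<close>, the mixture \<open>w'\<close> jumps between \<open>v2\<close> and \<open>v3\<close>; they differ only on inputs
  missing \<open>v5\<close>.\<close>

lemma no_mon_map_path:
  assumes n: "0 < n" and F: "mon_map n F dep"
    and v: "v0 < v1" "v1 < v2" "v2 < v3" "v3 < v4" "v3 \<le> v5" "v4 \<le> v6" "v5 < v6" "v6 \<le> v0 + int n"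
    and miss: "\<And>j. j \<notin> dep v0 \<and> j \<notin> dep v1 \<or> j \<notin> dep v1 \<and> j \<notin> dep v2 \<or>
      j \<notin> dep v2 \<and> j \<notin> dep v3 \<or> j \<notin> dep v3 \<and> j \<notin> dep v4 \<or> j \<notin> dep v5 \<and> j \<notin> dep v6"
  shows False
proof -
  obtain X where X: "F X v0" "\<not> F X v1" by (rule mon_map_break[OF n F, of v0 True]) (use v in auto)
  obtain Y where Y: "F Y v5" "\<not> F Y v6" by (rule mon_map_break[OF n F, of v5 True]) (use v in auto)
  obtain Z where Z: "\<not> F Z v3" "F Z v4" by (rule mon_map_break[OF n F, of v3 False]) (use v in auto)
  define A where "A j \<longleftrightarrow> j \<notin> dep v0 \<and> j \<notin> dep v1" for j
  define B where "B j \<longleftrightarrow> j \<notin> dep v1 \<and> j \<notin> dep v2" for j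
  define C where "C j \<longleftrightarrow> j \<notin> dep v2 \<and> j \<notin> dep v3" for j
  define D where "D j \<longleftrightarrow> j \<notin> dep v3 \<and> j \<notin> dep v4" for j
  \<comment> \<open>Each input belongs to the first pair of the path that it misses; the inputs left
    over miss \<open>v5\<close> and \<open>v6\<close> and take the fifth argument.\<close>
  define mix where "mix a b c d e j = (if A j then a j else if B j then b j else if C j then c j
    else if D j then d j else e j)" for a b c d e :: "_ \<Rightarrow> nat" and j
  have ABCD: "A j \<or> B j \<or> C j \<or> D j" if "j \<in> dep v5 \<or> j \<in> dep v6" for j
    using miss[of j] that by (auto simp: A_def B_def C_def D_def)
  have X0: "F (mix a X X X X) v0 = F X v0" "F (mix a X X X X) v1 = F X v1" for a
    by (auto intro!: mon_map_dep[OF F] simp: mix_def A_def)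
  have X3: "\<not> F (mix a X X X X) v3" for a
    using mon_map_after_break[OF n F, of "mix a X X X X" v0 v1 v3] X0[of a] X v by simp
  have mixY: "mix Y Y Y Y e j = Y j" if "j \<in> dep v5 \<or> j \<in> dep v6" for e j
    using ABCD[OF that] by (auto simp: mix_def)
  have Y0: "F (mix Y Y Y Y e) v5 = F Y v5" "F (mix Y Y Y Y e) v6 = F Y v6" for e
    by (auto intro!: mon_map_dep[OF F] simp: mixY)
  have Y2: "F (mix Y Y Y Y e) v2" for e
    using mon_map_after_break[OF n F, of "mix Y Y Y Y e" v5 v6 "v2 + int n"] Y0[of e] Y v
      mon_map_add[OF n F, of "mix Y Y Y Y e" v2] by simp
  have Z0: "F (mix Z Z Z d Z) v3 = F Z v3" "F (mix Z Z Z d Z) v4 = F Z v4" for d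
    by (auto intro!: mon_map_dep[OF F] simp: mix_def D_def)
  have Z1: "\<not> F (mix Z Z Z d Z) v1" for d
    using mon_map_after_break[OF n F, of "mix Z Z Z d Z" v3 v4 "v1 + int n"] Z0[of d] Z v
      mon_map_add[OF n F, of "mix Z Z Z d Z" v1] by simp
  let ?w = "mix Y X Z Y Z" and ?w' = "mix Y X Z Y X"
  \<comment> \<open>Classes \<open>A\<close> and \<open>B\<close> are not read at \<open>v1\<close>,
    \<open>B\<close> and \<open>C\<close> not at \<open>v2\<close>, \<open>C\<close> and
    \<open>D\<close> not at \<open>v3\<close>. At each of these positions two arguments of
    \<open>mix\<close> can thus be replaced to reach a mixture whose value is known.\<close>
  have "F ?w v1 = F (mix Z Z Z Y Z) v1" "F ?w v2 = F (mix Y Y Y Y Z) v2"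
    by (auto intro!: mon_map_dep[OF F] simp: mix_def A_def B_def C_def)
  then have "\<not> F ?w v1" "F ?w v2" using Y2 Z1 by simp_all
  then have "F ?w v5" using mon_map_after_break[OF n F, of ?w v1 v2 v5] v by simp
  have "F ?w' v2 = F (mix Y Y Y Y X) v2" "F ?w' v3 = F (mix Y X X X X) v3"
    by (auto intro!: mon_map_dep[OF F] simp: mix_def B_def C_def D_def)
  then have "F ?w' v2" "\<not> F ?w' v3" using X3 Y2 by simp_all
  then have "\<not> F ?w' v5" using mon_map_after_break[OF n F, of ?w' v2 v3 v5] v by simp
  moreover have "F ?w v5 = F ?w' v5"
  proof (rule mon_map_dep[OF F])
    fix j assume "j \<in> dep v5"
    then show "?w j = ?w' j" using ABCD[of j] by (auto simp: mix_def)
  qed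
  ultimately show False using \<open>F ?w v5\<close> by simp
qed

text \<open>After splitting, every input is missed on a whole avoidable interval, so the obstruction
  need only be checked on these. \<open>p\<close> and \<open>q\<close> are representatives taken
  from the \<open>n\<close> integers before \<open>v\<close>.\<close>

lemma not_generates_vertex:
  assumes n: "0 < n" and ne: "positions n \<notin> K"
    and pq: "p < v" "v \<le> p + int n" "q < v" "v \<le> q + int n"
    and miss: "\<And>a l. avoidable n K a l \<Longrightarrow> (v - a) mod int n < l \<or>
      (p - a) mod int n < l \<and> (p + 1 - a) mod int n < l \<or>
      (q - a) mod int n < l \<and> (q + 1 - a) mod int n < l"
  shows "\<not> generates (positions n) K (Mon n)"
proof
  assume "generates (positions n) K (Mon n)"
  then obtain F and dep :: "int \<Rightarrow> (nat \<times> int) set" where F: "mon_map n F dep"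
    and arcs: "\<And>j. \<exists>a l. avoidable n K a l \<and> (\<forall>i. (i - a) mod int n < l \<longrightarrow> j \<notin> dep i)"
    using generates_split[OF n _ ne] by metis
  show False
  proof (rule no_mon_map_vertex[OF n F pq])
    fix j
    from arcs[of j] obtain a l where al: "avoidable n K a l" and "\<forall>i. (i - a) mod int n < l \<longrightarrow> j \<notin> dep i"
      by auto
    with miss[OF al] show "j \<notin> dep v \<or> j \<notin> dep p \<and> j \<notin> dep (p + 1) \<or> j \<notin> dep q \<and> j \<notin> dep (q + 1)"
      by blast
  qed
qed

lemma not_generates_path:
  assumes n: "0 < n" and ne: "positions n \<notin> K"
    and v: "v0 < v1" "v1 < v2" "v2 < v3" "v3 < v4" "v3 \<le> v5" "v4 \<le> v6" "v5 < v6" "v6 \<le> v0 + int n"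
    and miss: "\<And>a l. avoidable n K a l \<Longrightarrow>
      (v0 - a) mod int n < l \<and> (v1 - a) mod int n < l \<or> (v1 - a) mod int n < l \<and> (v2 - a) mod int n < l \<or>
      (v2 - a) mod int n < l \<and> (v3 - a) mod int n < l \<or> (v3 - a) mod int n < l \<and> (v4 - a) mod int n < l \<or>
      (v5 - a) mod int n < l \<and> (v6 - a) mod int n < l"
  shows "\<not> generates (positions n) K (Mon n)"
proof
  assume "generates (positions n) K (Mon n)"
  then obtain F and dep :: "int \<Rightarrow> (nat \<times> int) set" where F: "mon_map n F dep"
    and arcs: "\<And>j. \<exists>a l. avoidable n K a l \<and> (\<forall>i. (i - a) mod int n < l \<longrightarrow> j \<notin> dep i)"
    using generates_split[OF n _ ne] by metis
  show False
  proof (rule no_mon_map_path[OF n F v])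
    fix j
    from arcs[of j] obtain a l where al: "avoidable n K a l" and "\<forall>i. (i - a) mod int n < l \<longrightarrow> j \<notin> dep i"
      by auto
    with miss[OF al] show "j \<notin> dep v0 \<and> j \<notin> dep v1 \<or> j \<notin> dep v1 \<and> j \<notin> dep v2 \<or>
      j \<notin> dep v2 \<and> j \<notin> dep v3 \<or> j \<notin> dep v3 \<and> j \<notin> dep v4 \<or> j \<notin> dep v5 \<and> j \<notin> dep v6"
      by blast
  qed
qed

section \<open>Complexes spanned by complements of intervals\<close>

lemma simplicial_complex_of:
  "\<lbrakk>F \<noteq> {}; \<And>S. S \<in> F \<Longrightarrow> S \<subseteq> I\<rbrakk> \<Longrightarrow> simplicial_complex_on I (complex_of F)"
  unfolding simplicial_complex_on_def complex_of_def by blast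

lemma complex_of_subset:
  assumes "simplicial_complex_on I K" and "F \<subseteq> K"
  shows "complex_of F \<subseteq> K"
  using assms unfolding simplicial_complex_on_def complex_of_def by blast

text \<open>Splitting the inputs shows that the arcs of \<open>K\<close> suffice to generate.\<close>

lemma minimal_generating_arcs:
  assumes n: "0 < n" and min: "minimal_generating (positions n) K (Mon n)" and ne: "positions n \<notin> K"
  shows "K = complex_of {positions n - block n a l | a l. avoidable n K a l}"
proof -
  let ?K = "complex_of {positions n - block n a l | a l. avoidable n K a l}"
  have gen: "generates (positions n) K (Mon n)" using min by (simp add: minimal_generating_def)
  then have sc: "simplicial_complex_on (positions n) K" by (simp add: generates_def)
  have sub: "?K \<subseteq> K" by (rule complex_of_subset[OF sc]) (auto simp: avoidable_def)
  from gen obtain F and dep :: "int \<Rightarrow> (nat \<times> int) set" and J where F: "mon_map n F dep"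
    and J: "finite J" "\<And>i. dep i \<subseteq> J"
    and arcs: "\<And>j. \<exists>a l. avoidable n K a l \<and> (\<forall>i. (i - a) mod int n < l \<longrightarrow> j \<notin> dep i)"
    by (rule generates_split[OF n _ ne]) blast
  have "generates (positions n) ?K (Mon n)"
  proof (rule generatesI[where F = F and dep = dep, OF n _ J(1)])
    show "simplicial_complex_on (positions n) ?K"
      by (rule simplicial_complex_of) (use arcs[of undefined] in auto)
    fix j
    from arcs[of j] obtain a l where "avoidable n K a l" "\<forall>i. (i - a) mod int n < l \<longrightarrow> j \<notin> dep i"
      by auto
    then have "{i \<in> positions n. j \<in> dep i} \<subseteq> positions n - block n a l" by (auto simp: block_def)
    with \<open>avoidable n K a l\<close> show "{i \<in> positions n. j \<in> dep i} \<in> ?K"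
      unfolding complex_of_def by auto
  next
    fix x from mon_map_cyc[OF F] obtain p where "\<forall>i. F x i = cyc n p i" ..
    then have "\<forall>i \<in> positions n. F x i = cyc n p i" by simp
    then show "\<exists>p. \<forall>i \<in> positions n. F x i = cyc n p i" ..
  next
    fix p from mon_map_surj[OF F] obtain x where "\<forall>i. F x i = cyc n p i" ..
    then show "\<exists>x. \<forall>i \<in> positions n. F x i = cyc n p i" by (intro exI[of _ x]) simp
  next
    fix x y :: "nat \<times> int \<Rightarrow> nat" and i assume "\<And>j. j \<in> dep i \<Longrightarrow> x j = y j"
    then show "F x i = F y i" by (rule mon_map_dep[OF F])
  qed (rule J(2))
  then show ?thesis using min sub unfolding minimal_generating_def by blast
qed

subsection \<open>Arcs and generating complexes\<close>

lemma in_arc_iff: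
  assumes n: "0 < n"
  shows "i \<in> arc n a b \<longleftrightarrow> i \<in> positions n \<and> (i - a) mod int n \<le> (b - a) mod int n"
proof
  assume "i \<in> arc n a b"
  then obtain c b' where c: "i = c mod int n" "a \<le> c" "c \<le> b'" and b': "b' mod int n = b mod int n"
    "a \<le> b'" "b' < a + int n"
    by (auto simp: arc_def)
  have "(b - a) mod int n = (b' - a) mod int n" using b'(1) by (metis mod_diff_left_eq)
  also have "\<dots> = b' - a" using b' by simp
  finally have "(b - a) mod int n = b' - a" .
  moreover have "(i - a) mod int n = c - a"
    using c b' by (simp add: mod_diff_left_eq)
  ultimately show "i \<in> positions n \<and> (i - a) mod int n \<le> (b - a) mod int n"
    using c n by (simp add: mod_in_positions)
next
  assume i: "i \<in> positions n \<and> (i - a) mod int n \<le> (b - a) mod int n"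
  have "i = (a + (i - a) mod int n) mod int n" using i by (simp add: mod_add_right_eq positions_mod)
  moreover have "(a + (b - a) mod int n) mod int n = b mod int n" by (simp add: mod_add_right_eq)
  moreover have "0 \<le> (i - a) mod int n" "(b - a) mod int n < int n" using n by simp_all
  ultimately show "i \<in> arc n a b"
    unfolding arc_def using i
    by (intro CollectI exI[of _ "a + (i - a) mod int n"] exI[of _ "a + (b - a) mod int n"]) auto
qed

lemma block_cong:
  assumes "a mod int n = b mod int n"
  shows "block n a l = block n b l"
proof -
  have "(i - a) mod int n = (i - b) mod int n" for i using assms by (metis mod_diff_right_eq)
  then show ?thesis by (simp add: block_def)
qed

text \<open>The complement of the interval of length \<open>l\<close> from \<open>a\<close> runs
  from \<open>a + l\<close> to \<open>a - 1\<close>. Endpoints are compared modulo \<open>n\<close>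
  to fit all representatives in use, and \<open>l < int n\<close> because an arc is never
  empty.\<close>

lemma arc_eq_block:
  assumes n: "0 < n" and l: "1 \<le> l" "l < int n"
    and c: "c mod int n = (a + l) mod int n" and b: "(b + 1) mod int n = a mod int n"
  shows "arc n c b = positions n - block n a l"
proof -
  have "b mod int n = (a - 1) mod int n" using b by (metis add_diff_cancel_right' mod_diff_left_eq)
  then have "(b - c) mod int n = (a - 1 - (a + l)) mod int n" by (rule mod_diff_cong[OF _ c])
  also have "\<dots> = (int n - l - 1) mod int n"
    using mod_add_self2[of "- l - 1" "int n"] by (simp add: algebra_simps)
  also have "\<dots> = int n - l - 1" using l by simp
  finally have bc: "(b - c) mod int n = int n - l - 1" .
  have "(i - c) mod int n \<le> int n - l - 1 \<longleftrightarrow> \<not> (i - a) mod int n < l" for i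
  proof -
    define r where "r = (i - a) mod int n"
    have r: "0 \<le> r" "r < int n" using n by (simp_all add: r_def)
    have "(i - c) mod int n = (i - (a + l)) mod int n" using c by (metis mod_diff_right_eq)
    also have "\<dots> = (r - l) mod int n" by (simp add: r_def mod_simps algebra_simps)
    also have "\<dots> = (if r < l then r - l + int n else r - l)"
    proof (cases "r < l")
      case True
      have "(r - l) mod int n = (r - l + int n) mod int n" by simp
      also have "\<dots> = r - l + int n" using r l True by (intro mod_pos_pos_trivial) auto
      finally show ?thesis using True by simp
    next
      case False
      then show ?thesis using r l by simp
    qed
    finally show ?thesis unfolding r_def[symmetric] using r l by auto
  qed
  then show ?thesis using bc in_arc_iff[OF n] by (auto simp: block_def)
qed

lemma circ_perm_complex_of: "circ_perm n c (complex_of F) = complex_of ((\<lambda>S. (\<lambda>x. (x + c) mod int n) ` S) ` F)"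
proof (intro equalityI subsetI)
  fix T assume "T \<in> circ_perm n c (complex_of F)"
  then show "T \<in> complex_of ((\<lambda>S. (\<lambda>x. (x + c) mod int n) ` S) ` F)"
    by (auto simp: circ_perm_def complex_of_def)
next
  fix T assume "T \<in> complex_of ((\<lambda>S. (\<lambda>x. (x + c) mod int n) ` S) ` F)"
  then obtain S where S: "S \<in> F" "T \<subseteq> (\<lambda>x. (x + c) mod int n) ` S" by (auto simp: complex_of_def)
  then obtain U where "U \<subseteq> S" "T = (\<lambda>x. (x + c) mod int n) ` U" by (auto simp: subset_image_iff)
  with S show "T \<in> circ_perm n c (complex_of F)" by (auto simp: circ_perm_def complex_of_def)
qed

lemma rotate_block:
  assumes n: "0 < n"
  shows "(\<lambda>x. (x + c) mod int n) ` (positions n - block n a l) = positions n - block n (a + c) l"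
proof (intro equalityI subsetI)
  fix y assume "y \<in> (\<lambda>x. (x + c) mod int n) ` (positions n - block n a l)"
  then obtain x where x: "x \<in> positions n" "\<not> (x - a) mod int n < l" "y = (x + c) mod int n"
    by (auto simp: block_def)
  then show "y \<in> positions n - block n (a + c) l"
    using n by (simp add: block_def mod_in_positions mod_diff_left_eq)
next
  fix y assume y: "y \<in> positions n - block n (a + c) l"
  then have y': "y \<in> positions n" "\<not> (y - (a + c)) mod int n < l" by (auto simp: block_def)
  define x where "x = (y - c) mod int n"
  have "(x + c) mod int n = y" using y' by (simp add: x_def mod_simps positions_mod)
  moreover have "(x - a) mod int n = (y - (a + c)) mod int n"
    by (simp add: x_def mod_simps algebra_simps)
  then have "x \<in> positions n - block n a l"
    using y' n by (simp add: block_def x_def mod_in_positions)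
  ultimately show "y \<in> (\<lambda>x. (x + c) mod int n) ` (positions n - block n a l)" by force
qed

lemma in_block_linear:
  assumes "i \<in> positions n" and "0 \<le> a" "0 \<le> l" "a + l \<le> int n"
  shows "i \<in> block n a l \<longleftrightarrow> a \<le> i \<and> i < a + l"
proof (cases "a \<le> i")
  case True
  then show ?thesis using assms by (auto simp: block_def positions_def)
next
  case False
  have "(i - a) mod int n = (i - a + int n) mod int n" by simp
  also have "\<dots> = i - a + int n" using assms False by (intro mod_pos_pos_trivial) (auto simp: positions_def)
  finally show ?thesis using assms False by (auto simp: block_def positions_def)
qed

section \<open>Generating maps for the \<open>K2\<close> and \<open>K5\<close> families\<close>

lemma cyc_step:
  assumes "0 < n" and "0 \<le> b" "b < int n"
  shows "\<exists>p. \<forall>i \<in> positions n. (if i < b then u else w) = cyc n p i"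
proof -
  define p where "p = (if u then if w then int n else b else if w then int n + b else 0)"
  have p: "0 \<le> p" "p < 2 * int n" using assms by (auto simp: p_def)
  have "(if i < b then u else w) = cyc n p i" if "i \<in> positions n" for i
    using that assms unfolding cyc_positions[OF that p] by (auto simp: p_def positions_def)
  then show ?thesis by blast
qed

text \<open>Both inputs propose a string; \<open>a\<close> reads only input 1 and \<open>b\<close>
  only input 0. If the proposals agree at both places, the string of input 0 is the output;
  otherwise the bits \<open>u\<close> and \<open>w\<close> are joined by a step just before
  \<open>b\<close>.\<close>

lemma generates_K2:
  assumes a: "a \<in> positions n" and b: "b \<in> positions n" and ab: "a < b"
  shows "generates (positions n) (complex_of {positions n - {a}, positions n - {b}}) (Mon n)"
proof -
  have n: "0 < n" using a by (auto simp: positions_def)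
  define F where "F x i = (let u = cyc n (int (x 1)) a; w = cyc n (int (x 0)) b in
    if i = a then u else if i = b then w
    else if cyc n (int (x 0)) a = u \<and> cyc n (int (x 1)) b = w then cyc n (int (x 0)) i else if i < b then u else w)"
    for x :: "nat \<Rightarrow> nat" and i
  define dep where "dep i = (if i = a then {1} else if i = b then {0} else {0, 1 :: nat})" for i
  show ?thesis
  proof (rule generatesI[where F = F and dep = dep and J = "{0, 1 :: nat}"])
    show "simplicial_complex_on (positions n) (complex_of {positions n - {a}, positions n - {b}})"
      by (rule simplicial_complex_of) auto
    fix x :: "nat \<Rightarrow> nat"
    let ?u = "cyc n (int (x 1)) a" and ?w = "cyc n (int (x 0)) b"
    show "\<exists>p. \<forall>i \<in> positions n. F x i = cyc n p i"
    proof (cases "cyc n (int (x 0)) a = ?u \<and> cyc n (int (x 1)) b = ?w")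
      case True
      then have "\<forall>i \<in> positions n. F x i = cyc n (int (x 0)) i" by (simp add: F_def Let_def)
      then show ?thesis ..
    next
      case False
      then have "F x i = (if i < b then ?u else ?w)" for i
        unfolding F_def Let_def if_not_P[OF False] using ab by simp
      then show ?thesis using cyc_step[OF n, of b] b by (simp add: positions_def)
    qed
  next
    fix p :: int assume "0 \<le> p"
    then have "\<forall>i \<in> positions n. F (\<lambda>_. nat p) i = cyc n p i" by (simp add: F_def Let_def)
    then show "\<exists>x. \<forall>i \<in> positions n. F x i = cyc n p i" by (rule exI[of _ "\<lambda>_. nat p"])
  next
    fix x y :: "nat \<Rightarrow> nat" and i assume "\<And>j. j \<in> dep i \<Longrightarrow> x j = y j"
    then have "i \<noteq> a \<Longrightarrow> x 0 = y 0" "i = a \<or> i \<noteq> b \<Longrightarrow> x 1 = y 1" by (auto simp: dep_def split: if_splits)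
    then show "F x i = F y i" using ab by (cases "i = a"; cases "i = b") (simp_all add: F_def Let_def)
  next
    fix j :: nat assume "j \<in> {0, 1}"
    then show "{i \<in> positions n. j \<in> dep i} \<in> complex_of {positions n - {a}, positions n - {b}}"
      using ab by (auto simp: complex_of_def dep_def split: if_splits)
  qed (use n in \<open>auto simp: dep_def\<close>)
qed

lemma K5_eq_blocks:
  assumes "1 < h" "h < k" "k < int n - 1"
  shows "K5 n h k = complex_of {positions n - block n 0 1, positions n - block n k (int n - k),
    positions n - block n h (k - h + 1), positions n - block n 1 h}"
proof -
  have "arc n 1 (int n - 1) = positions n - block n 0 1"
    by (rule arc_eq_block) (use assms in auto)
  moreover have "arc n 0 (k - 1) = positions n - block n k (int n - k)"
    by (rule arc_eq_block) (use assms in auto)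
  moreover have "arc n (k + 1) (h - 1) = positions n - block n h (k - h + 1)"
    by (rule arc_eq_block) (use assms in auto)
  moreover have "arc n (h + 1) 0 = positions n - block n 1 h"
    by (rule arc_eq_block) (use assms in \<open>auto simp: add.commute\<close>)
  ultimately show ?thesis by (simp add: K5_def)
qed

text \<open>Input 0 is a target string and the inputs 1, 2, 3 propose the bit at 0, which is decided by
  majority; the jump of the target is realised only if the two proposals visible there agree.\<close>

lemma generates_K5:
  assumes hk: "1 < h" "h < k" "k < int n - 1"
  shows "generates (positions n) (K5 n h k) (Mon n)"
proof -
  have n: "0 < n" using hk by simp
  have n1: "2 \<le> int n" using hk by simp
  define t where "t x j = cyc n (int (x j)) 0" for x :: "nat \<Rightarrow> nat" and j
  \<comment> \<open>The target jumps between \<open>r x\<close> and \<open>r x + 1\<close>. The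
    constant targets, the points 0 and \<open>n\<close>, have \<open>r x = n - 1\<close>, beyond
    which there is no position.\<close>
  define r where "r x = (int (x 0) - 1) mod int n" for x :: "nat \<Rightarrow> nat"
  \<comment> \<open>For \<open>r x < h\<close> the positions up to the jump read inputs 2 and 3; for
    \<open>r x\<close> at least \<open>k\<close> those after it read 1 and 2; in the middle range
    the left side reads 3 and the right side 1. If these proposals do not support the jump, the
    positions other than 0 become constant, and then either bit at 0 is admissible.\<close>
  define F where "F x i = (
    if i = 0 then t x 1 \<and> t x 2 \<or> t x 2 \<and> t x 3 \<or> t x 1 \<and> t x 3
    else if r x < h then (i \<le> r x \<and> t x 2 = t x 0 \<and> t x 3 = t x 0) = t x 0
    else if r x < k then (if i \<le> r x then t x 3 else \<not> t x 1)
    else (i \<le> r x \<or> t x 1 \<noteq> t x 0 \<or> t x 2 \<noteq> t x 0) = t x 0)" for x and i :: int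
  define dep where "dep i = (if i = 0 then {} else {0}) \<union> (if i \<in> block n 1 h then {} else {1}) \<union>
    (if i \<in> block n h (k - h + 1) then {} else {2}) \<union>
    (if i \<in> block n k (int n - k) then {} else {3 :: nat})" for i
  have blocks: "i \<in> block n 1 h \<longleftrightarrow> 1 \<le> i \<and> i \<le> h" "i \<in> block n h (k - h + 1) \<longleftrightarrow> h \<le> i \<and> i \<le> k"
    "i \<in> block n k (int n - k) \<longleftrightarrow> k \<le> i" "i \<in> block n 0 1 \<longleftrightarrow> i = 0" if "i \<in> positions n" for i
    using that hk in_block_linear[OF that, of 1 h] in_block_linear[OF that, of h "k - h + 1"]
      in_block_linear[OF that, of k "int n - k"] in_block_linear[OF that, of 0 1]
    by (auto simp: positions_def)
  show ?thesis
    unfolding K5_eq_blocks[OF hk]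
  proof (rule generatesI[where F = F and dep = dep and J = "{0, 1, 2, 3 :: nat}"])
    show "simplicial_complex_on (positions n) (complex_of {positions n - block n 0 1,
      positions n - block n k (int n - k), positions n - block n h (k - h + 1), positions n - block n 1 h})"
      by (rule simplicial_complex_of) auto
    fix x :: "nat \<Rightarrow> nat"
    let ?m = "t x 1 \<and> t x 2 \<or> t x 2 \<and> t x 3 \<or> t x 1 \<and> t x 3"
    have rx: "0 \<le> r x" "r x < int n" using n by (simp_all add: r_def)
    have jump: "\<exists>p. \<forall>i \<in> positions n. F x i = cyc n p i"
      if "\<forall>i \<in> positions n. F x i = (if i < b then u else w)" and "0 \<le> b" "b < int n" for b u w
      using cyc_step[OF n that(2,3), of u w] that(1) by simp
    show "\<exists>p. \<forall>i \<in> positions n. F x i = cyc n p i"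
    proof (cases "r x < h")
      case True
      show ?thesis
      proof (cases "t x 2 = t x 0 \<and> t x 3 = t x 0")
        case eq: True
        have "\<forall>i \<in> positions n. F x i = (if i < r x + 1 then t x 0 else \<not> t x 0)"
          using True eq rx by (auto simp: F_def positions_def)
        then show ?thesis by (rule jump) (use True hk rx in simp_all)
      next
        case False
        have "\<forall>i \<in> positions n. F x i = (if i < 1 then ?m else \<not> t x 0)"
          using True False by (auto simp: F_def positions_def)
        then show ?thesis by (rule jump) (use n1 in simp_all)
      qed
    next
      case h: False
      show ?thesis
      proof (cases "r x < k")
        case True
        show ?thesis
        proof (cases "t x 1 = t x 3")
          case eq: True
          have "\<forall>i \<in> positions n. F x i = (if i < r x + 1 then t x 3 else \<not> t x 3)"
            using True h eq rx by (auto simp: F_def positions_def)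
        then show ?thesis by (rule jump) (use True hk rx in simp_all)
        next
          case False
          have "\<forall>i \<in> positions n. F x i = (if i < 1 then ?m else t x 3)"
            using True h False by (auto simp: F_def positions_def)
          then show ?thesis by (rule jump) (use n1 in simp_all)
        qed
      next
        case kr: False
        show ?thesis
        proof (cases "t x 1 = t x 0 \<and> t x 2 = t x 0 \<and> r x + 1 < int n")
          case eq: True
          have "\<forall>i \<in> positions n. F x i = (if i < r x + 1 then t x 0 else \<not> t x 0)"
            using kr h eq rx by (auto simp: F_def positions_def)
          then show ?thesis by (rule jump) (use rx eq in simp_all)
        next
          case False
          have "\<forall>i \<in> positions n. F x i = (if i < 1 then ?m else t x 0)"
            using kr h False by (auto simp: F_def positions_def)
          then show ?thesis by (rule jump) (use n1 in simp_all)
        qed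
      qed
    qed
  next
    fix p :: int assume p: "0 \<le> p" "p < 2 * int n"
    have pos0: "0 \<in> positions n" using n by (simp add: positions_def)
    have tp: "t (\<lambda>_. nat p) j = (if p < int n then 0 < p else p \<le> int n)" for j
      using p cyc_positions[OF pos0 p] by (simp add: t_def)
    have rp: "r (\<lambda>_. nat p) = (if p = 0 then int n - 1 else if p \<le> int n then p - 1 else p - int n - 1)"
    proof -
      consider "p = 0" | "0 < p" "p \<le> int n" | "int n < p" using p by linarith
      then show ?thesis
      proof cases
        case 1
        then show ?thesis using n by (simp add: r_def zmod_minus1)
      next
        case 2
        then show ?thesis by (simp add: r_def)
      next
        case 3
        have "(p - 1) mod int n = (p - 1 - int n) mod int n" by simp
        also have "\<dots> = p - 1 - int n" using 3 p by (intro mod_pos_pos_trivial) auto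
        finally show ?thesis using 3 p by (simp add: r_def)
      qed
    qed
    have "F (\<lambda>_. nat p) i = cyc n p i" if i: "i \<in> positions n" for i
      unfolding cyc_positions[OF i p] F_def tp rp using i p hk by (auto simp: positions_def)
    then show "\<exists>x. \<forall>i \<in> positions n. F x i = cyc n p i" by (intro exI[of _ "\<lambda>_. nat p"]) simp
  next
    fix x y :: "nat \<Rightarrow> nat" and i assume i: "i \<in> positions n" and eq: "\<And>j. j \<in> dep i \<Longrightarrow> x j = y j"
    have 0: "t x 0 = t y 0" "r x = r y" if "i \<noteq> 0" using eq[of 0] that by (simp_all add: dep_def t_def r_def)
    have 1: "t x 1 = t y 1" if "\<not> (1 \<le> i \<and> i \<le> h)" using eq[of 1] that i by (simp add: dep_def t_def blocks)
    have 2: "t x 2 = t y 2" if "\<not> (h \<le> i \<and> i \<le> k)" using eq[of 2] that i by (simp add: dep_def t_def blocks)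
    have 3: "t x 3 = t y 3" if "\<not> k \<le> i" using eq[of 3] that i by (simp add: dep_def t_def blocks)
    show "F x i = F y i"
    proof (cases "i = 0")
      case True
      then show ?thesis using 1 2 3 hk by (simp add: F_def)
    next
      case False
      then have "0 < i" using i by (auto simp: positions_def)
      consider "r y < h" "i \<le> r y" | "r y < h" "r y < i" | "h \<le> r y" "r y < k" "i \<le> r y" |
        "h \<le> r y" "r y < k" "r y < i" | "k \<le> r y" "i \<le> r y" | "k \<le> r y" "r y < i" by linarith
      then show ?thesis
        by cases (use 0 1 2 3 hk False in \<open>simp_all add: F_def\<close>)
    qed
  next
    fix j :: nat assume "j \<in> {0, 1, 2, 3}"
    then consider "j = 0" | "j = 1" | "j = 2" | "j = 3" by auto
    then show "{i \<in> positions n. j \<in> dep i} \<in> complex_of {positions n - block n 0 1,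
      positions n - block n k (int n - k), positions n - block n h (k - h + 1), positions n - block n 1 h}"
      by cases (auto simp: complex_of_def dep_def blocks split: if_splits)
  qed (use n in \<open>auto simp: dep_def\<close>)
qed

lemma generates_complex_ofI:
  fixes F :: "('j::countable \<Rightarrow> nat) \<Rightarrow> int \<Rightarrow> bool" and S :: "'j \<Rightarrow> int set"
  assumes n: "0 < n" and J: "finite J" "J \<noteq> {}" and S: "\<And>j. j \<in> J \<Longrightarrow> S j \<subseteq> positions n"
    and cyc: "\<And>x. \<exists>p. \<forall>i \<in> positions n. F x i = cyc n p i"
    and surj: "\<And>p. 0 \<le> p \<Longrightarrow> p < 2 * int n \<Longrightarrow> \<exists>x. \<forall>i \<in> positions n. F x i = cyc n p i"
    and dep: "\<And>x y i. i \<in> positions n \<Longrightarrow> (\<And>j. j \<in> J \<Longrightarrow> i \<in> S j \<Longrightarrow> x j = y j) \<Longrightarrow> F x i = F y i"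
  shows "generates (positions n) (complex_of (S ` J)) (Mon n)"
proof (rule generatesI[where F = F and dep = "\<lambda>i. {j \<in> J. i \<in> S j}", OF n _ J(1) cyc surj])
  show "simplicial_complex_on (positions n) (complex_of (S ` J))"
    by (rule simplicial_complex_of) (use J S in auto)
  fix x y :: "'j \<Rightarrow> nat" and i
  assume "i \<in> positions n" "\<And>j. j \<in> {j \<in> J. i \<in> S j} \<Longrightarrow> x j = y j"
  then show "F x i = F y i" by (intro dep) auto
qed (auto simp: complex_of_def)

section \<open>The complexes \<open>K6\<close> and \<open>K7\<close>\<close>

lemma positions_6: "positions 6 = {0, 1, 2, 3, 4, 5}"
  and positions_7: "positions 7 = {0, 1, 2, 3, 4, 5, 6}"
  by (auto simp: positions_def)

lemma K6_eq_blocks: "K6 = complex_of {positions 6 - block 6 4 2, positions 6 - block 6 5 2,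
    positions 6 - block 6 0 2, positions 6 - block 6 1 2, positions 6 - block 6 2 2, positions 6 - block 6 3 2}"
proof -
  have "arc 6 0 3 = positions 6 - block 6 4 2" "arc 6 1 4 = positions 6 - block 6 5 2"
    "arc 6 2 5 = positions 6 - block 6 0 2" "arc 6 3 0 = positions 6 - block 6 1 2"
    "arc 6 4 1 = positions 6 - block 6 2 2" "arc 6 5 2 = positions 6 - block 6 3 2"
    by (rule arc_eq_block; simp)+
  then show ?thesis unfolding K6_def by presburger
qed

lemma K7_eq_blocks: "K7 = complex_of {positions 7 - block 7 5 2, positions 7 - block 7 6 2,
    positions 7 - block 7 0 2, positions 7 - block 7 2 2, positions 7 - block 7 3 2}"
proof -
  have "arc 7 0 4 = positions 7 - block 7 5 2" "arc 7 1 5 = positions 7 - block 7 6 2"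
    "arc 7 2 6 = positions 7 - block 7 0 2" "arc 7 4 1 = positions 7 - block 7 2 2"
    "arc 7 5 2 = positions 7 - block 7 3 2"
    by (rule arc_eq_block; simp)+
  then show ?thesis unfolding K7_def by presburger
qed

text \<open>The map on simplices in \<open>ins\<close> is monotone, hence it may be applied to the
  generators alone.\<close>

lemma ins_complex_of: "ins n i (complex_of F) = complex_of
     ((\<lambda>S. if (i - 1) mod int n \<in> S \<or> i mod int n \<in> S
           then rho_plus i ` S \<union> {i} else rho_plus i ` S) ` F)"
  (is "_ = complex_of (?\<phi> ` F)")
proof -
  have mono: "?\<phi> S \<subseteq> ?\<phi> T" if "S \<subseteq> T" for S T using that by auto
  show ?thesis
  proof (intro equalityI subsetI)
    fix T assume "T \<in> ins n i (complex_of F)"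
    then obtain S U where SU: "U \<in> F" "S \<subseteq> U" "T \<subseteq> ?\<phi> S" by (auto simp: ins_def complex_of_def)
    then have "T \<subseteq> ?\<phi> U" using mono[OF SU(2)] by (meson subset_trans)
    then show "T \<in> complex_of (?\<phi> ` F)" using SU(1) unfolding complex_of_def by blast
  next
    fix T assume "T \<in> complex_of (?\<phi> ` F)"
    then obtain U where "U \<in> F" "T \<subseteq> ?\<phi> U" unfolding complex_of_def by blast
    moreover from this have "U \<in> complex_of F" by (auto simp: complex_of_def)
    ultimately show "T \<in> ins n i (complex_of F)" unfolding ins_def complex_of_def[of "_ ` _"] by blast
  qed
qed

text \<open>The new vertex 1 lies between the former vertices 0 and 1. Only the missed interval {0,
  1} contains both neighbours and grows to length 3; the others are at most shifted.\<close>

lemma ins_K6_eq_blocks: "ins 6 1 K6 = complex_of {positions 7 - block 7 0 3, positions 7 - block 7 2 2,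
    positions 7 - block 7 3 2, positions 7 - block 7 4 2, positions 7 - block 7 5 2, positions 7 - block 7 6 2}"
proof -
  have 6: "positions 6 - block 6 4 2 = {0, 1, 2, 3}" "positions 6 - block 6 5 2 = {1, 2, 3, 4}"
    "positions 6 - block 6 0 2 = {2, 3, 4, 5}" "positions 6 - block 6 1 2 = {0, 3, 4, 5}"
    "positions 6 - block 6 2 2 = {0, 1, 4, 5}" "positions 6 - block 6 3 2 = {0, 1, 2, 5}"
    unfolding block_def positions_6 by auto
  have 7: "positions 7 - block 7 5 2 = {0, 1, 2, 3, 4}" "positions 7 - block 7 6 2 = {1, 2, 3, 4, 5}"
    "positions 7 - block 7 0 3 = {3, 4, 5, 6}" "positions 7 - block 7 2 2 = {0, 1, 4, 5, 6}"
    "positions 7 - block 7 3 2 = {0, 1, 2, 5, 6}" "positions 7 - block 7 4 2 = {0, 1, 2, 3, 6}"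
    unfolding block_def positions_7 by auto
  show ?thesis
    unfolding K6_eq_blocks ins_complex_of 6 7
    by (rule arg_cong[of _ _ complex_of]) (simp add: rho_plus_def insert_commute)
qed

text \<open>The table was found by a search over the maps with five binary inputs.\<close>

lemma generates_K7: "generates (positions 7) K7 (Mon 7)"
proof -
  define F where "F x i = (
    let a = 0 < x 0; b = 0 < x 1; c = 0 < x 2; d = 0 < x 3; e = 0 < x 4 in
    [if a then d \<and> \<not> e else d \<or> e,
     if a then \<not> b \<and> d \<and> \<not> e else b \<or> d \<or> e,
     if a then \<not> b \<and> c \<and> \<not> e else b \<or> c \<or> e,
     if a then \<not> b \<and> c else b \<or> c,
     if b then (if a then c \<and> \<not> d else c \<or> \<not> d) else c,
     if b then (if c then \<not> d \<or> e else \<not> d \<and> \<not> e) else c,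
     if c then \<not> d \<or> e else \<not> d \<and> \<not> e] ! nat i)" for x :: "nat \<Rightarrow> nat" and i
  define S where "S j = positions 7 - block 7 ([5, 6, 0, 2, 3] ! j) 2" for j
  have cyc7: "cyc 7 p i \<longleftrightarrow> (if p < 7 then i < p else p - 7 \<le> i)" if "i \<in> positions 7" "0 \<le> p" "p < 14" for p i
    using cyc_positions[OF that(1,2)] that(3) by simp
  have S: "S 0 = {0, 1, 2, 3, 4}" "S (Suc 0) = {1, 2, 3, 4, 5}" "S 2 = {2, 3, 4, 5, 6}" "S 3 = {0, 1, 4, 5, 6}"
    "S 4 = {0, 1, 2, 5, 6}"
    unfolding S_def block_def positions_7 by auto
  have "generates (positions 7) (complex_of (S ` {0, 1, 2, 3, 4})) (Mon 7)"
  proof (rule generates_complex_ofI[where F = F])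
    fix x :: "nat \<Rightarrow> nat"
    \<comment> \<open>Only the positivity of the five inputs matters, which leaves 32 cases.\<close>
    have "\<exists>p \<in> {0, 1, 2, 3, 4, 5, 6, 7, 8, 9, 10, 11, 12, 13}. \<forall>i \<in> positions 7. F x i = cyc 7 p i"
      by (cases "0 < x 0"; cases "0 < x 1"; cases "0 < x 2"; cases "0 < x 3"; cases "0 < x 4";
          simp add: F_def positions_7 cyc7)
    then show "\<exists>p. \<forall>i \<in> positions 7. F x i = cyc 7 p i" by auto
  next
    fix p :: int assume p: "0 \<le> p" "p < 2 * int 7"
    \<comment> \<open>One input vector for each of the 14 points, in order.\<close>
    define W :: "int \<Rightarrow> nat \<Rightarrow> nat" where "W q = nth ([
      [1, 0, 0, 0, 1], [1, 1, 0, 1, 0], [0, 0, 0, 1, 0], [0, 0, 0, 0, 1], [0, 1, 0, 1, 0],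
      [0, 1, 0, 0, 1], [0, 0, 1, 1, 0], [0, 0, 1, 0, 1], [0, 1, 0, 0, 0], [0, 0, 1, 0, 0],
      [1, 0, 1, 0, 1], [1, 1, 1, 0, 0], [1, 1, 0, 0, 0], [0, 0, 0, 0, 0]] ! nat q)" for q
    have "p \<in> {0, 1, 2, 3, 4, 5, 6} \<or> p - 7 \<in> {0, 1, 2, 3, 4, 5, 6}"
      using p unfolding positions_7[symmetric] by (auto simp: positions_def)
    then have "p \<in> {0, 1, 2, 3, 4, 5, 6, 7, 8, 9, 10, 11, 12, 13}" by auto
    moreover have "\<forall>q \<in> {0, 1, 2, 3, 4, 5, 6, 7, 8, 9, 10, 11, 12, 13}. \<forall>i \<in> positions 7. F (W q) i = cyc 7 q i"
      by (simp add: F_def W_def positions_7 cyc7)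
    ultimately have "\<forall>i \<in> positions 7. F (W p) i = cyc 7 p i" by (rule bspec[rotated])
    then show "\<exists>x. \<forall>i \<in> positions 7. F x i = cyc 7 p i" by (rule exI[of _ "W p"])
  next
    fix x y :: "nat \<Rightarrow> nat" and i assume i: "i \<in> positions 7"
      and eq: "\<And>j. j \<in> {0, 1, 2, 3, 4} \<Longrightarrow> i \<in> S j \<Longrightarrow> x j = y j"
    from i consider "i = 0" | "i = 1" | "i = 2" | "i = 3" | "i = 4" | "i = 5" | "i = 6"
      by (auto simp: positions_7)
    then show "F x i = F y i"
      using eq[of 0] eq[of 1] eq[of 2] eq[of 3] eq[of 4] by cases (simp_all add: F_def Let_def S)
  qed (auto simp: S_def)
  also have "complex_of (S ` {0, 1, 2, 3, 4}) = K7"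
    unfolding K7_eq_blocks S_def by (rule arg_cong[of _ _ complex_of]) simp
  finally show ?thesis .
qed

subsection \<open>Avoidable arcs\<close>

lemma block_mono:
  assumes "a \<le> a'" and "a' + l' \<le> a + l" and "l \<le> int n"
  shows "block n a' l' \<subseteq> block n a l"
proof
  fix i assume "i \<in> block n a' l'"
  then have i: "i \<in> positions n" "(i - a') mod int n < l'" by (auto simp: block_def)
  then have n: "0 < int n" by (auto simp: positions_def)
  have "(i - a) mod int n = ((i - a') mod int n + (a' - a)) mod int n" by (simp add: mod_add_left_eq)
  also have "\<dots> = (i - a') mod int n + (a' - a)"
    using i n assms by (intro mod_pos_pos_trivial) auto
  finally show "i \<in> block n a l" using i assms by (simp add: block_def)
qed

lemma avoidable_mono:
  assumes "simplicial_complex_on (positions n) K" and "avoidable n K a' l'"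
    and "a \<le> a'" "a' + l' \<le> a + l" "l \<le> int n"
  shows "avoidable n K a l"
proof -
  have "positions n - block n a l \<subseteq> positions n - block n a' l'"
    using block_mono[OF assms(3-5)] by auto
  then show ?thesis using assms by (auto simp: avoidable_def simplicial_complex_on_def)
qed

lemma avoidable_cong:
  "a mod int n = b mod int n \<Longrightarrow> avoidable n K a l \<longleftrightarrow> avoidable n K b l"
  using block_cong[of a n b l] by (simp add: avoidable_def)

text \<open>The least right endpoint \<open>\<alpha>\<close> and the greatest left endpoint \<open>\<beta>\<close> of the arcs avoiding \<open>a\<close>
  decide between a member of the \<open>K\<^sub>5\<close> family and the obstruction.\<close>

lemma avoidable_single:
  assumes n: "2 \<le> n" and gen: "generates (positions n) K (Mon n)" and ne: "positions n \<notin> K"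
    and single: "\<And>b. avoidable n K b 1 \<Longrightarrow> b mod int n = a mod int n"
  obtains h k where "1 < h" "h < k" "k < int n - 1" and "avoidable n K (a + k) (int n - k)"
    and "avoidable n K (a + h) (k - h + 1)" and "avoidable n K (a + 1) h"
proof (rule ccontr)
  assume "\<not> thesis"
  then have none: "\<not> (1 < h \<and> h < k \<and> k < int n - 1 \<and> avoidable n K (a + k) (int n - k) \<and>
      avoidable n K (a + h) (k - h + 1) \<and> avoidable n K (a + 1) h)" for h k
    using that by blast
  have n0: "0 < n" using n by simp
  have sc: "simplicial_complex_on (positions n) K" using gen by (simp add: generates_def)
  \<comment> \<open>The avoidable intervals without \<open>a\<close>, given by end points strictly
    between \<open>a\<close> and \<open>a + n\<close>. By \<open>single\<close> none of them has
    length 1, whence \<open>x < y\<close>.\<close>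
  define D where "D = {(x, y). a < x \<and> x < y \<and> y < a + int n \<and> avoidable n K x (y - x + 1)}"
  have finD: "finite D"
    by (rule finite_subset[of _ "{a..a + int n} \<times> {a..a + int n}"]) (auto simp: D_def)
  have cases: "(a + int n - b) mod int n < l \<or> (\<exists>x y. (x, y) \<in> D \<and>
      (\<forall>p. x \<le> p \<and> p \<le> y \<longrightarrow> (p - b) mod int n < l))" if b: "avoidable n K b l" for b l
  proof -
    \<comment> \<open>The representative of \<open>b\<close> among \<open>a + 1\<close> to
      \<open>a + n\<close>; the interval from there reaches \<open>a + n\<close> unless it belongs
      to \<open>D\<close>.\<close>
    define x where "x = a + 1 + (b - a - 1) mod int n"
    have xb: "x mod int n = b mod int n" by (simp add: x_def mod_simps)
    have l: "1 \<le> l" "l \<le> int n" using b by (auto simp: avoidable_def)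
    have pb: "(p - b) mod int n = (p - x) mod int n" for p using xb by (metis mod_diff_right_eq)
    have "0 \<le> (b - a - 1) mod int n" "(b - a - 1) mod int n < int n" using n by simp_all
    then have x: "a < x" "x \<le> a + int n" by (simp_all add: x_def)
    show ?thesis
    proof (cases "x + l - 1 < a + int n")
      case True
      have "l \<noteq> 1"
      proof
        assume "l = 1"
        then have "x mod int n = a mod int n" using single b xb by simp
        then have "int n dvd x - a" by (rule mod_eq_dvd_iff[THEN iffD1])
        moreover have "0 < x - a" "x - a < int n" using x True \<open>l = 1\<close> by simp_all
        ultimately show False using zdvd_not_zless by blast
      qed
      then have "(x, x + l - 1) \<in> D"
        using x True l b avoidable_cong[OF xb] by (simp add: D_def)
      moreover have "(p - b) mod int n < l" if "x \<le> p" "p \<le> x + l - 1" for p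
        using that l by (simp add: pb)
      ultimately show ?thesis by blast
    next
      case False
      have "(a + int n - x) mod int n \<le> a + int n - x" using x by (simp add: zmod_le_nonneg_dividend)
      then show ?thesis using False by (simp add: pb)
    qed
  qed
  show False
  proof (cases "D = {}")
    case True
    \<comment> \<open>All avoidable intervals contain \<open>a\<close>, so the vertex obstruction
      holds with any choice of edges.\<close>
    have "\<not> generates (positions n) K (Mon n)"
      by (rule not_generates_vertex[OF n0 ne, of "a + int n - 1" "a + int n" "a + int n - 1"])
        (use cases True n in auto)
    then show False using gen ..
  next
    case False
    define \<alpha> where "\<alpha> = Min (snd ` D)"
    define \<beta> where "\<beta> = Max (fst ` D)"
    have "\<alpha> \<in> snd ` D" "\<beta> \<in> fst ` D" using finD False by (auto simp: \<alpha>_def \<beta>_def)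
    then obtain x\<^sub>1 y\<^sub>2 where \<alpha>: "(x\<^sub>1, \<alpha>) \<in> D" and \<beta>: "(\<beta>, y\<^sub>2) \<in> D" by auto
    have bounds: "\<alpha> \<le> y" "x \<le> \<beta>" if "(x, y) \<in> D" for x y
      using finD that by (force simp: \<alpha>_def \<beta>_def intro: Min_le Max_ge)+
    \<comment> \<open>An interval of \<open>D\<close> between \<alpha> and \<beta>, with the one
      ending at \<alpha> enlarged down to \<open>a + 1\<close> and the one starting at \<beta>
      enlarged up to \<open>a + n - 1\<close>, would be the excluded configuration for
      \<open>h = \<alpha> - a\<close> and \<open>k = \<beta> - a\<close>.\<close>
    have short: "\<not> (\<alpha> \<le> x \<and> y \<le> \<beta>)" if xy: "(x, y) \<in> D" for x y
    proof
      assume le: "\<alpha> \<le> x \<and> y \<le> \<beta>"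
      have "avoidable n K (a + (\<beta> - a)) (int n - (\<beta> - a))"
        by (rule avoidable_mono[OF sc, of \<beta> "y\<^sub>2 - \<beta> + 1"]) (use \<beta> in \<open>auto simp: D_def\<close>)
      moreover have "avoidable n K (a + (\<alpha> - a)) ((\<beta> - a) - (\<alpha> - a) + 1)"
        by (rule avoidable_mono[OF sc, of x "y - x + 1"]) (use xy le \<alpha> \<beta> in \<open>auto simp: D_def\<close>)
      moreover have "avoidable n K (a + 1) (\<alpha> - a)"
        by (rule avoidable_mono[OF sc, of x\<^sub>1 "\<alpha> - x\<^sub>1 + 1"]) (use \<alpha> in \<open>auto simp: D_def\<close>)
      ultimately show False
        using none[of "\<alpha> - a" "\<beta> - a"] \<alpha> \<beta> xy le by (auto simp: D_def)
    qed
    \<comment> \<open>If \<beta> < \<alpha>, all intervals of \<open>D\<close> contain the edge at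
      \<beta>. Otherwise those reaching beyond \<beta> contain it, while those ending by \<beta>
      start before \<alpha> by \<open>short\<close> and contain the edge at
      \<open>\<alpha> - 1\<close>.\<close>
    define p where "p = (if \<beta> < \<alpha> then \<beta> else \<alpha> - 1)"
    have edges: "x \<le> p \<and> p + 1 \<le> y \<or> x \<le> \<beta> \<and> \<beta> + 1 \<le> y" if "(x, y) \<in> D" for x y
      using bounds[OF that] short[OF that] by (auto simp: p_def)
    have "\<not> generates (positions n) K (Mon n)"
    proof (rule not_generates_vertex[OF n0 ne, of p "a + int n" \<beta>])
      fix b l assume "avoidable n K b l"
      from cases[OF this] show "(a + int n - b) mod int n < l \<or>
        (p - b) mod int n < l \<and> (p + 1 - b) mod int n < l \<or>
        (\<beta> - b) mod int n < l \<and> (\<beta> + 1 - b) mod int n < l"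
      proof
        assume "\<exists>x y. (x, y) \<in> D \<and> (\<forall>p. x \<le> p \<and> p \<le> y \<longrightarrow> (p - b) mod int n < l)"
        then obtain x y where "(x, y) \<in> D" and "\<forall>p. x \<le> p \<and> p \<le> y \<longrightarrow> (p - b) mod int n < l" by auto
        with edges[of x y] show ?thesis by auto
      qed simp
    qed (use \<alpha> \<beta> in \<open>auto simp: D_def p_def\<close>)
    then show False using gen ..
  qed
qed

section \<open>At most seven positions with no single vertex avoidable\<close>

lemma residue_cases:
  assumes "0 < n"
  obtains r where "0 \<le> r" "r < int n" and "a mod int n = (c + r) mod int n"
    and "\<And>i. (c + i - a) mod int n = (i - r) mod int n"
proof -
  define r where "r = (a - c) mod int n"
  have ar: "a mod int n = (c + r) mod int n" by (simp add: r_def mod_simps)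
  have "(c + i - a) mod int n = (i - r) mod int n" for i
  proof -
    have "(c + i - a) mod int n = (c + i - (c + r)) mod int n" using ar by (metis mod_diff_right_eq)
    then show ?thesis by simp
  qed
  moreover have "0 \<le> r" "r < int n" using assms by (simp_all add: r_def)
  ultimately show ?thesis using that ar by blast
qed

text \<open>An interval of length at least 2 that avoids vertex 0 contains the edge {1, 2} or {n -
  2, n - 1} when \<open>n\<close> is 3 or 4, and does not exist when \<open>n = 2\<close>.\<close>

lemma not_generates_no_single_small:
  assumes n: "2 \<le> n" "n \<le> 4" and ne: "positions n \<notin> K" and no: "\<And>a. \<not> avoidable n K a 1"
  shows "\<not> generates (positions n) K (Mon n)"
proof (rule not_generates_vertex[OF _ ne, of 1 "int n" "int n - 2 + of_bool (n = 2)"])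
  fix a l assume al: "avoidable n K a l"
  then have l: "2 \<le> l" using no by (cases "l = 1") (auto simp: avoidable_def)
  obtain r where r: "0 \<le> r" "r < int n" and eq: "\<And>i. (0 + i - a) mod int n = (i - r) mod int n"
    by (rule residue_cases[of n a 0]) (use n in auto)
  have mod: "(i - a) mod int n = (i - r) mod int n" for i using eq by simp
  have "n = 2 \<or> n = 3 \<or> n = 4" "r = 0 \<or> r = 1 \<or> r = 2 \<or> r = 3" using n r by linarith+
  then show "(int n - a) mod int n < l \<or>
      (1 - a) mod int n < l \<and> (1 + 1 - a) mod int n < l \<or>
      (int n - 2 + of_bool (n = 2) - a) mod int n < l \<and> (int n - 2 + of_bool (n = 2) + 1 - a) mod int n < l"
    unfolding mod by (elim disjE) (use l r in simp_all)
qed (use n in auto)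

text \<open>The path from 0 to 4 and the edge from 4 back to 0 comprise all edges of the pentagon,
  so every interval of length at least 2 is caught.\<close>

lemma not_generates_no_single_5:
  assumes ne: "positions 5 \<notin> K" and no: "\<And>a. \<not> avoidable 5 K a 1"
  shows "\<not> generates (positions 5) K (Mon 5)"
proof (rule not_generates_path[OF _ ne, of 0 1 2 3 4 4 5])
  fix a l assume al: "avoidable 5 K a l"
  then have l: "2 \<le> l" using no by (cases "l = 1") (auto simp: avoidable_def)
  obtain r where r: "0 \<le> r" "r < int 5" and eq: "\<And>i. (0 + i - a) mod int 5 = (i - r) mod int 5"
    by (rule residue_cases[of 5 a 0]) auto
  have mod: "(i - a) mod int 5 = (i - r) mod int 5" for i using eq by simp
  have "r = 0 \<or> r = 1 \<or> r = 2 \<or> r = 3 \<or> r = 4" using r by auto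
  then show "(0 - a) mod int 5 < l \<and> (1 - a) mod int 5 < l \<or> (1 - a) mod int 5 < l \<and> (2 - a) mod int 5 < l \<or>
      (2 - a) mod int 5 < l \<and> (3 - a) mod int 5 < l \<or> (3 - a) mod int 5 < l \<and> (4 - a) mod int 5 < l \<or>
      (4 - a) mod int 5 < l \<and> (5 - a) mod int 5 < l"
    unfolding mod by (elim disjE) (use l in simp_all)
qed auto

text \<open>The path and the extra edge leave out only the edge from \<open>c\<close> to
  \<open>c + 1\<close>. Longer intervals starting at \<open>c\<close> contain the edge at
  \<open>c + 1\<close>.\<close>

lemma not_generates_no_single_6:
  assumes ne: "positions 6 \<notin> K" and no: "\<And>a. \<not> avoidable 6 K a 1" and c: "\<not> avoidable 6 K c 2"
  shows "\<not> generates (positions 6) K (Mon 6)"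
proof (rule not_generates_path[OF _ ne, of "c + 1" "c + 2" "c + 3" "c + 4" "c + 5" "c + 5" "c + 6"])
  fix a l assume al: "avoidable 6 K a l"
  then have l: "2 \<le> l" using no by (cases "l = 1") (auto simp: avoidable_def)
  obtain r where r: "0 \<le> r" "r < int 6" and ar: "a mod int 6 = (c + r) mod int 6"
    and mod: "\<And>i. (c + i - a) mod int 6 = (i - r) mod int 6"
    by (rule residue_cases[of 6 a c]) auto
  have l3: "3 \<le> l" if "r = 0" using al c l avoidable_cong[of a 6 c K l] ar that by (cases "l = 2") auto
  have "r = 0 \<or> r = 1 \<or> r = 2 \<or> r = 3 \<or> r = 4 \<or> r = 5" using r by auto
  then show "(c + 1 - a) mod int 6 < l \<and> (c + 2 - a) mod int 6 < l \<or>
      (c + 2 - a) mod int 6 < l \<and> (c + 3 - a) mod int 6 < l \<or>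
      (c + 3 - a) mod int 6 < l \<and> (c + 4 - a) mod int 6 < l \<or>
      (c + 4 - a) mod int 6 < l \<and> (c + 5 - a) mod int 6 < l \<or>
      (c + 5 - a) mod int 6 < l \<and> (c + 6 - a) mod int 6 < l"
    unfolding mod by (elim disjE) (use l l3 in simp_all)
qed auto

text \<open>Each clause is an instance of the path obstruction: the intervals of length at least 2
  that contain no pair of the chosen path or the extra pair are exactly those named in the
  clause.\<close>

lemma no_single_7:
  assumes gen: "generates (positions 7) K (Mon 7)" and ne: "positions 7 \<notin> K"
    and no: "\<And>a. \<not> avoidable 7 K a 1"
  shows "avoidable 7 K c 2 \<or> avoidable 7 K (c + 2) 2"
    and "avoidable 7 K c 2 \<or> avoidable 7 K (c + 1) 2 \<or> avoidable 7 K c 3"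
    and "avoidable 7 K c 2 \<or> avoidable 7 K (c + 1) 2 \<or> avoidable 7 K (c + 4) 2"
proof -
  have two: "2 \<le> l" if "avoidable 7 K a l" for a l
    using no that by (cases "l = 1") (auto simp: avoidable_def)
  have other: "l \<noteq> k" if "avoidable 7 K a l" "\<not> avoidable 7 K b k" "a mod int 7 = b mod int 7" for a b l k
    using avoidable_cong[OF that(3), of K l] that by auto
  show "avoidable 7 K c 2 \<or> avoidable 7 K (c + 2) 2"
  proof (rule ccontr)
    assume neg: "\<not> ?thesis"
    have "\<not> generates (positions 7) K (Mon 7)"
    proof (rule not_generates_path[OF _ ne, of "c + 3" "c + 4" "c + 5" "c + 6" "c + 7" "c + 8" "c + 9"])
      fix a l assume al: "avoidable 7 K a l"
      obtain r where r: "0 \<le> r" "r < int 7" and ar: "a mod int 7 = (c + r) mod int 7"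
        and mod: "\<And>i. (c + i - a) mod int 7 = (i - r) mod int 7"
        by (rule residue_cases[of 7 a c]) auto
      have "2 \<le> l" "r = 0 \<Longrightarrow> l \<noteq> 2" "r = 2 \<Longrightarrow> l \<noteq> 2"
        using two[OF al] other[OF al, of c 2] other[OF al, of "c + 2" 2] neg ar by auto
      moreover have "r = 0 \<or> r = 1 \<or> r = 2 \<or> r = 3 \<or> r = 4 \<or> r = 5 \<or> r = 6" using r by auto
      ultimately show "(c + 3 - a) mod int 7 < l \<and> (c + 4 - a) mod int 7 < l \<or>
          (c + 4 - a) mod int 7 < l \<and> (c + 5 - a) mod int 7 < l \<or>
          (c + 5 - a) mod int 7 < l \<and> (c + 6 - a) mod int 7 < l \<or>
          (c + 6 - a) mod int 7 < l \<and> (c + 7 - a) mod int 7 < l \<or>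
          (c + 8 - a) mod int 7 < l \<and> (c + 9 - a) mod int 7 < l"
        unfolding mod by (elim disjE) simp_all
    qed auto
    then show False using gen ..
  qed
  show "avoidable 7 K c 2 \<or> avoidable 7 K (c + 1) 2 \<or> avoidable 7 K c 3"
  proof (rule ccontr)
    assume neg: "\<not> ?thesis"
    have "\<not> generates (positions 7) K (Mon 7)"
    proof (rule not_generates_path[OF _ ne, of "c + 2" "c + 3" "c + 4" "c + 5" "c + 6" "c + 6" "c + 7"])
      fix a l assume al: "avoidable 7 K a l"
      obtain r where r: "0 \<le> r" "r < int 7" and ar: "a mod int 7 = (c + r) mod int 7"
        and mod: "\<And>i. (c + i - a) mod int 7 = (i - r) mod int 7"
        by (rule residue_cases[of 7 a c]) auto
      have "2 \<le> l" "r = 0 \<Longrightarrow> l \<noteq> 2" "r = 0 \<Longrightarrow> l \<noteq> 3" "r = 1 \<Longrightarrow> l \<noteq> 2"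
        using two[OF al] other[OF al, of c 2] other[OF al, of c 3] other[OF al, of "c + 1" 2] neg ar by auto
      moreover have "r = 0 \<or> r = 1 \<or> r = 2 \<or> r = 3 \<or> r = 4 \<or> r = 5 \<or> r = 6" using r by auto
      ultimately show "(c + 2 - a) mod int 7 < l \<and> (c + 3 - a) mod int 7 < l \<or>
          (c + 3 - a) mod int 7 < l \<and> (c + 4 - a) mod int 7 < l \<or>
          (c + 4 - a) mod int 7 < l \<and> (c + 5 - a) mod int 7 < l \<or>
          (c + 5 - a) mod int 7 < l \<and> (c + 6 - a) mod int 7 < l \<or>
          (c + 6 - a) mod int 7 < l \<and> (c + 7 - a) mod int 7 < l"
        unfolding mod by (elim disjE) simp_all
    qed auto
    then show False using gen ..
  qed
  show "avoidable 7 K c 2 \<or> avoidable 7 K (c + 1) 2 \<or> avoidable 7 K (c + 4) 2"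
  proof (rule ccontr)
    assume neg: "\<not> ?thesis"
    \<comment> \<open>The path steps from \<open>c + 7\<close> directly to \<open>c + 9\<close>.
      This pair is contained in an interval of length 3 from \<open>c\<close>, but in neither of the
      two edges inside it.\<close>
    have "\<not> generates (positions 7) K (Mon 7)"
    proof (rule not_generates_path[OF _ ne, of "c + 5" "c + 6" "c + 7" "c + 9" "c + 10" "c + 10" "c + 11"])
      fix a l assume al: "avoidable 7 K a l"
      obtain r where r: "0 \<le> r" "r < int 7" and ar: "a mod int 7 = (c + r) mod int 7"
        and mod: "\<And>i. (c + i - a) mod int 7 = (i - r) mod int 7"
        by (rule residue_cases[of 7 a c]) auto
      have "2 \<le> l" "r = 0 \<Longrightarrow> l \<noteq> 2" "r = 1 \<Longrightarrow> l \<noteq> 2" "r = 4 \<Longrightarrow> l \<noteq> 2"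
        using two[OF al] other[OF al, of c 2] other[OF al, of "c + 1" 2] other[OF al, of "c + 4" 2] neg ar by auto
      moreover have "r = 0 \<or> r = 1 \<or> r = 2 \<or> r = 3 \<or> r = 4 \<or> r = 5 \<or> r = 6" using r by auto
      ultimately show "(c + 5 - a) mod int 7 < l \<and> (c + 6 - a) mod int 7 < l \<or>
          (c + 6 - a) mod int 7 < l \<and> (c + 7 - a) mod int 7 < l \<or>
          (c + 7 - a) mod int 7 < l \<and> (c + 9 - a) mod int 7 < l \<or>
          (c + 9 - a) mod int 7 < l \<and> (c + 10 - a) mod int 7 < l \<or>
          (c + 10 - a) mod int 7 < l \<and> (c + 11 - a) mod int 7 < l"
        unfolding mod by (elim disjE) simp_all
    qed auto
    then show False using gen ..
  qed
qed

subsection \<open>Minimal complexes\<close>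

lemma minimal_generating_eq:
  assumes "minimal_generating I K L" and "generates I K' L" and "K' \<subseteq> K"
  shows "K = K'"
  using assms unfolding minimal_generating_def by blast

text \<open>For complexes known to generate it suffices to find a rotated copy of their missed
  intervals among the avoidable ones; minimality excludes anything more.\<close>

lemma minimal_generating_circ_perm:
  assumes n: "0 < n" and min: "minimal_generating (positions n) K (Mon n)"
    and K': "K' = complex_of ((\<lambda>(a, l). positions n - block n a l) ` P)"
    and gen: "generates (positions n) K' (Mon n)"
    and P: "\<And>a l. (a, l) \<in> P \<Longrightarrow> avoidable n K (a + c) l"
  shows "K = circ_perm n c K'"
proof (rule minimal_generating_eq[OF min generates_circ_perm[OF n gen]])
  have sc: "simplicial_complex_on (positions n) K"
    using min by (simp add: minimal_generating_def generates_def)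
  show "circ_perm n c K' \<subseteq> K"
    unfolding K' circ_perm_complex_of
    by (rule complex_of_subset[OF sc]) (use P rotate_block[OF n] in \<open>auto simp: avoidable_def\<close>)
qed

text \<open>The outcomes are the interval patterns of \<open>K7\<close> and of \<open>K6\<close>
  with one inserted vertex. Two adjacent failures of \<open>P\<close> force the second. At an
  isolated failure \<open>c\<close>, \<open>P\<close> holds at \<open>c + 2\<close>,
  \<open>c + 5\<close> and one of \<open>c + 3\<close>, \<open>c + 4\<close>; either choice gives
  the first.\<close>

lemma cyclic_7_cases:
  fixes P T :: "int \<Rightarrow> bool"
  assumes per: "\<And>c. P (c + 7) = P c"
    and 1: "\<And>c. P c \<or> P (c + 2)" and 2: "\<And>c. P c \<or> P (c + 1) \<or> T c"
    and 3: "\<And>c. P c \<or> P (c + 1) \<or> P (c + 4)"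
  obtains c where "P c" "P (c + 2)" "P (c + 3)" "P (c + 5)" "P (c + 6)"
  | c where "T c" "\<not> P c" "\<not> P (c + 1)" "P (c + 2)" "P (c + 3)" "P (c + 4)" "P (c + 5)" "P (c + 6)"
proof -
  note spread = that(1) and run = that(2)
  have adjacent: thesis if c: "\<not> P c" "\<not> P (c + 1)" for c
  proof (rule run[of c])
    show "T c" using 2[of c] c by simp
    show "P (c + 2)" "P (c + 3)" "P (c + 4)" using 1[of c] 1[of "c + 1"] 3[of c] c by (simp_all add: algebra_simps)
    show "P (c + 5)" "P (c + 6)"
      using 1[of "c + 5"] 1[of "c + 6"] per[of c] per[of "c + 1"] c by (simp_all add: algebra_simps)
  qed (use c in simp_all)
  show thesis
  proof (cases "\<forall>c. P c")
    case True
    then show thesis using spread[of 0] by simp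
  next
    case False
    then obtain c where c: "\<not> P c" by auto
    have per': "P (c + 7) = P c" "P (c + 8) = P (c + 1)" "P (c + 9) = P (c + 2)"
      using per[of c] per[of "c + 1"] per[of "c + 2"] by (simp_all add: algebra_simps)
    show thesis
    proof (cases "P (c + 1) \<and> P (c + 6)")
      case True
      have c25: "P (c + 2)" "P (c + 5)" "P (c + 3) \<or> P (c + 4)"
        using 1[of c] 1[of "c + 5"] 3[of "c + 3"] c per' by (simp_all add: algebra_simps)
      show thesis
      proof (cases "P (c + 3)")
        case True
        then show thesis
          using spread[of "c + 3"] c25 \<open>P (c + 1) \<and> P (c + 6)\<close> per' by (simp add: algebra_simps)
      next
        case False
        have "P (c - 1) = P (c + 6)" using per[of "c - 1"] by (simp add: algebra_simps)
        then show thesis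
          using spread[of "c - 1"] c25 False \<open>P (c + 1) \<and> P (c + 6)\<close> by (simp add: algebra_simps)
      qed
    next
      case False
      then show thesis
        using adjacent[of c] adjacent[of "c + 6"] c per' by (auto simp: algebra_simps)
    qed
  qed
qed

text \<open>By \<open>minimal_generating_arcs\<close>, \<open>K\<close> is spanned by its avoidable
  intervals, so \<open>F\<close> spans it once each of them contains an interval missed by a member
  of \<open>F\<close>. For this \<open>cover\<close> offers the same start or a start one
  later.\<close>

lemma minimal_eq_arcs:
  assumes n: "0 < n" and min: "minimal_generating (positions n) K (Mon n)" and ne: "positions n \<notin> K"
    and F: "\<And>S. S \<in> F \<Longrightarrow> \<exists>a l. S = positions n - block n a l \<and> avoidable n K a l"
    and cover: "\<And>a l. avoidable n K a l \<Longrightarrow> \<exists>a' l'. positions n - block n a' l' \<in> F \<and>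
      a' mod int n = a mod int n \<and> l' \<le> l \<or>
      positions n - block n a' l' \<in> F \<and> a' mod int n = (a + 1) mod int n \<and> l' + 1 \<le> l"
  shows "K = complex_of F"
proof -
  have sc: "simplicial_complex_on (positions n) K"
    using min by (simp add: minimal_generating_def generates_def)
  have "complex_of F \<subseteq> K"
    by (rule complex_of_subset[OF sc]) (use F in \<open>auto simp: avoidable_def\<close>)
  moreover have "K \<subseteq> complex_of F"
  proof
    fix T assume "T \<in> K"
    have "T \<in> complex_of {positions n - block n a l | a l. avoidable n K a l}"
      using \<open>T \<in> K\<close> by (simp only: minimal_generating_arcs[OF n min ne, symmetric])
    then obtain a l where T: "T \<subseteq> positions n - block n a l" and al: "avoidable n K a l"
      by (auto simp: complex_of_def)
    then have l: "l \<le> int n" by (simp add: avoidable_def)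
    from cover[OF al] obtain a' l' where F': "positions n - block n a' l' \<in> F"
      and "a' mod int n = a mod int n \<and> l' \<le> l \<or> a' mod int n = (a + 1) mod int n \<and> l' + 1 \<le> l"
      by auto
    then have "block n a' l' \<subseteq> block n a l"
      using block_cong[of a' n a l'] block_cong[of a' n "a + 1" l'] block_mono[OF _ _ l, of a a l']
        block_mono[OF _ _ l, of a "a + 1" l'] by auto
    then have "T \<subseteq> positions n - block n a' l'" using T by auto
    then show "T \<in> complex_of F" using F' by (auto simp: complex_of_def)
  qed
  ultimately show ?thesis by simp
qed

lemma minimal_generating_K2:
  assumes min: "minimal_generating (positions n) K (Mon n)"
    and a: "a \<in> positions n" "positions n - {a} \<in> K"
    and b: "b \<in> positions n" "positions n - {b} \<in> K" and ab: "a \<noteq> b"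
  shows "K \<in> K2_family n"
  using a b ab
proof (induction a b rule: linorder_wlog)
  case (le a b)
  then have "a < b" by simp
  have sc: "simplicial_complex_on (positions n) K"
    using min by (simp add: minimal_generating_def generates_def)
  have "K = complex_of {positions n - {a}, positions n - {b}}"
  proof (rule minimal_generating_eq[OF min])
    show "generates (positions n) (complex_of {positions n - {a}, positions n - {b}}) (Mon n)"
      using generates_K2 le \<open>a < b\<close> by simp
    show "complex_of {positions n - {a}, positions n - {b}} \<subseteq> K"
      by (rule complex_of_subset[OF sc]) (use le in simp)
  qed
  then show ?case using le unfolding K2_family_def by blast
next
  case (sym a b)
  then show ?case by simp
qed

lemma minimal_generating_K5:
  assumes n: "2 \<le> n" and min: "minimal_generating (positions n) K (Mon n)" and ne: "positions n \<notin> K"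
    and a: "avoidable n K a 1" and single: "\<And>b. avoidable n K b 1 \<Longrightarrow> b mod int n = a mod int n"
  shows "K \<in> K5_family n"
proof -
  have n0: "0 < n" using n by simp
  have gen: "generates (positions n) K (Mon n)" using min by (simp add: minimal_generating_def)
  obtain h k where hk: "1 < h" "h < k" "k < int n - 1" and av: "avoidable n K (a + k) (int n - k)"
    "avoidable n K (a + h) (k - h + 1)" "avoidable n K (a + 1) h"
    by (rule avoidable_single[OF n gen ne single])
  have "K = circ_perm n a (K5 n h k)"
  proof (rule minimal_generating_circ_perm[OF n0 min _ generates_K5[OF hk]])
    let ?P = "{(0, 1), (k, int n - k), (h, k - h + 1), (1, h)}"
    show "K5 n h k = complex_of ((\<lambda>(a, l). positions n - block n a l) ` ?P)"
      by (simp add: K5_eq_blocks[OF hk])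
    show "avoidable n K (b + a) l" if "(b, l) \<in> ?P" for b l
      using that a av by (auto simp: add.commute)
  qed
  moreover have "5 \<le> n" using hk by simp
  ultimately show ?thesis using hk unfolding K5_family_def by blast
qed

text \<open>The arcs of \<open>K\<close> are exactly those of \<open>K6\<close>, so the conclusion does not depend on whether \<open>K6\<close>
  generates.\<close>

lemma minimal_generating_6:
  assumes min: "minimal_generating (positions 6) K (Mon 6)" and ne: "positions 6 \<notin> K"
    and no: "\<And>a. \<not> avoidable 6 K a 1"
  shows "K = K6"
proof -
  have gen: "generates (positions 6) K (Mon 6)" using min by (simp add: minimal_generating_def)
  have av: "avoidable 6 K c 2" for c
    using not_generates_no_single_6[OF ne no, of c] gen by auto
  have two: "2 \<le> l" if "avoidable 6 K a l" for a l
    using no that by (cases "l = 1") (auto simp: avoidable_def)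
  let ?F = "{positions 6 - block 6 4 2, positions 6 - block 6 5 2, positions 6 - block 6 0 2,
    positions 6 - block 6 1 2, positions 6 - block 6 2 2, positions 6 - block 6 3 2}"
  have "K = complex_of ?F"
  proof (rule minimal_eq_arcs[OF _ min ne])
    fix a l assume "avoidable 6 K a l"
    then have l: "2 \<le> l" by (rule two)
    obtain r where r: "0 \<le> r" "r < int 6" and ar: "a mod int 6 = (0 + r) mod int 6"
      by (rule residue_cases[of 6 a 0]) auto
    have "r = 0 \<or> r = 1 \<or> r = 2 \<or> r = 3 \<or> r = 4 \<or> r = 5" using r by auto
    then have "positions 6 - block 6 r 2 \<in> ?F" by (elim disjE) simp_all
    moreover have "r mod int 6 = a mod int 6" using ar by simp
    ultimately show "\<exists>a' l'. positions 6 - block 6 a' l' \<in> ?F \<and> a' mod int 6 = a mod int 6 \<and> l' \<le> l \<or>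
        positions 6 - block 6 a' l' \<in> ?F \<and> a' mod int 6 = (a + 1) mod int 6 \<and> l' + 1 \<le> l"
      using l by (intro exI[of _ r] exI[of _ 2] disjI1) simp
  next
    fix S assume "S \<in> ?F"
    then show "\<exists>a l. S = positions 6 - block 6 a l \<and> avoidable 6 K a l" using av by auto
  qed simp
  then show ?thesis by (simp add: K6_eq_blocks)
qed

text \<open>In the first outcome of \<open>cyclic_7_cases\<close>, \<open>K\<close> contains a
  rotated \<open>K7\<close>, which generates, and minimality gives equality. In the second the
  inclusion-minimal avoidable intervals are determined completely, and \<open>K\<close> is computed
  from them.\<close>

lemma minimal_generating_7:
  assumes min: "minimal_generating (positions 7) K (Mon 7)" and ne: "positions 7 \<notin> K"
    and no: "\<And>a. \<not> avoidable 7 K a 1"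
  shows "K \<in> K6_family 7 \<union> K7_family 7"
proof -
  have gen: "generates (positions 7) K (Mon 7)" using min by (simp add: minimal_generating_def)
  have two: "2 \<le> l" if "avoidable 7 K a l" for a l
    using no that by (cases "l = 1") (auto simp: avoidable_def)
  have per: "avoidable 7 K (c + 7) 2 = avoidable 7 K c 2" for c
    by (rule avoidable_cong) simp
  show ?thesis
  proof (rule cyclic_7_cases[where P = "\<lambda>c. avoidable 7 K c 2" and T = "\<lambda>c. avoidable 7 K c 3",
        OF per no_single_7[OF gen ne no]])
    fix c assume av: "avoidable 7 K c 2" "avoidable 7 K (c + 2) 2" "avoidable 7 K (c + 3) 2"
      "avoidable 7 K (c + 5) 2" "avoidable 7 K (c + 6) 2"
    have "K = circ_perm 7 c K7"
    proof (rule minimal_generating_circ_perm[OF _ min _ generates_K7])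
      let ?P = "{(5, 2), (6, 2), (0, 2), (2, 2), (3, 2)}"
      show "K7 = complex_of ((\<lambda>(a, l). positions 7 - block 7 a l) ` ?P)"
        by (simp add: K7_eq_blocks)
      show "avoidable 7 K (a + c) l" if "(a, l) \<in> ?P" for a l
        using that av by (auto simp: add.commute)
    qed simp
    then have "obtained 7 K7 7 K" by (simp add: obtained.start obtained.permutation)
    then show ?thesis by (simp add: K7_family_def)
  next
    fix c assume av: "avoidable 7 K c 3" "\<not> avoidable 7 K c 2" "\<not> avoidable 7 K (c + 1) 2"
      "avoidable 7 K (c + 2) 2" "avoidable 7 K (c + 3) 2" "avoidable 7 K (c + 4) 2"
      "avoidable 7 K (c + 5) 2" "avoidable 7 K (c + 6) 2"
    let ?F = "{positions 7 - block 7 (0 + c) 3, positions 7 - block 7 (2 + c) 2,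
      positions 7 - block 7 (3 + c) 2, positions 7 - block 7 (4 + c) 2,
      positions 7 - block 7 (5 + c) 2, positions 7 - block 7 (6 + c) 2}"
    have "K = complex_of ?F"
    proof (rule minimal_eq_arcs[OF _ min ne])
      fix S assume "S \<in> ?F"
      then show "\<exists>a l. S = positions 7 - block 7 a l \<and> avoidable 7 K a l"
        using av by (auto simp: add.commute)
    next
      fix a l assume al: "avoidable 7 K a l"
      then have l: "2 \<le> l" by (rule two)
      obtain r where r: "0 \<le> r" "r < int 7" and ar: "a mod int 7 = (c + r) mod int 7"
        by (rule residue_cases[of 7 a c]) auto
      have ar1: "(a + 1) mod int 7 = (c + r + 1) mod int 7"
        using ar by (metis mod_add_left_eq)
      \<comment> \<open>The pairs at \<open>c\<close> and \<open>c + 1\<close> are not avoidable, so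
        an interval from \<open>c\<close> contains the triple there, and one from
        \<open>c + 1\<close> contains the pair at \<open>c + 2\<close>.\<close>
      have l3: "3 \<le> l" if "r = 0 \<or> r = 1"
        using al av avoidable_cong[OF ar, of K 2] that l by (cases "l = 2") auto
      have "r = 0 \<or> r = 1 \<or> r = 2 \<or> r = 3 \<or> r = 4 \<or> r = 5 \<or> r = 6" using r by auto
      then consider "r = 0" | "r = 1" | "positions 7 - block 7 (r + c) 2 \<in> ?F"
        by (elim disjE) simp_all
      then show "\<exists>a' l'. positions 7 - block 7 a' l' \<in> ?F \<and> a' mod int 7 = a mod int 7 \<and> l' \<le> l \<or>
          positions 7 - block 7 a' l' \<in> ?F \<and> a' mod int 7 = (a + 1) mod int 7 \<and> l' + 1 \<le> l"
      proof cases
        case 1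
        then show ?thesis using l3 ar by (intro exI[of _ "0 + c"] exI[of _ 3] disjI1) simp
      next
        case 2
        then show ?thesis
          using l3 ar1 by (intro exI[of _ "2 + c"] exI[of _ 2] disjI2) (simp add: add.commute)
      next
        case 3
        then show ?thesis
          using l ar by (intro exI[of _ "r + c"] exI[of _ 2] disjI1) (simp add: add.commute)
      qed
    qed simp
    also have "\<dots> = circ_perm 7 c (ins 6 1 K6)"
      unfolding ins_K6_eq_blocks circ_perm_complex_of
      by (rule arg_cong[of _ _ complex_of]) (use rotate_block[of 7 c] in simp)
    finally have "K = circ_perm 7 c (ins 6 1 K6)" .
    moreover have "obtained 6 K6 (Suc 6) (ins 6 1 K6)"
      by (rule obtained.insertion[OF obtained.start]) auto
    ultimately have "obtained 6 K6 7 K" by (simp add: obtained.permutation)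
    then show ?thesis by (simp add: K6_family_def)
  qed
qed

theorem theorem6p14:
  fixes n :: nat and K :: "int set set"
  assumes "2 \<le> n" and "n \<le> 7"
    and "minimal_generating (positions n) K (Mon n)"
  shows "K \<in> K2_family n \<union> K5_family n \<union> K6_family n \<union> K7_family n"
proof (cases "positions n \<in> K")
  case True
  have "simplicial_complex_on (positions n) K"
    using assms(3) by (simp add: minimal_generating_def generates_def)
  \<comment> \<open>\<open>K\<close> now contains a member of the \<open>K2\<close> family, and
    minimality makes them equal; as that member lacks the full simplex, this case is in fact
    void.\<close>
  with True have "positions n - S \<in> K" for S by (auto simp: simplicial_complex_on_def)
  moreover have "0 \<in> positions n" "1 \<in> positions n" using assms(1) by (auto simp: positions_def)
  ultimately show ?thesis using minimal_generating_K2[OF assms(3), of 0 1] by simp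
next
  case ne: False
  have n0: "0 < n" using assms(1) by simp
  have gen: "generates (positions n) K (Mon n)" using assms(3) by (simp add: minimal_generating_def)
  show ?thesis
  \<comment> \<open>The number of vertices that can be missed singly decides: two give the
    \<open>K2\<close> family, exactly one the \<open>K5\<close> family, and with none the bound on
    \<open>n\<close> leaves finitely many configurations.\<close>
  proof (cases "\<exists>a. avoidable n K a 1")
    case True
    then obtain a where a: "avoidable n K a 1" ..
    show ?thesis
    proof (cases "\<exists>b. avoidable n K b 1 \<and> b mod int n \<noteq> a mod int n")
      case True
      then obtain b where b: "avoidable n K b 1" "b mod int n \<noteq> a mod int n" by auto
      have single: "positions n - {c mod int n} \<in> K" if "avoidable n K c 1" for c
      proof -
        have c: "c mod int n \<in> positions n" using n0 by (rule mod_in_positions)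
        have "i \<in> block n (c mod int n) 1 \<longleftrightarrow> i = c mod int n" if "i \<in> positions n" for i
          using in_block_linear[OF that, of "c mod int n" 1] c by (auto simp: positions_def)
        then have "positions n - block n (c mod int n) 1 = positions n - {c mod int n}" by auto
        then show ?thesis using that block_cong[of c n "c mod int n" 1] by (simp add: avoidable_def)
      qed
      have "K \<in> K2_family n"
        by (rule minimal_generating_K2[OF assms(3)
              mod_in_positions[OF n0] single[OF a] mod_in_positions[OF n0] single[OF b(1)]])
          (use b(2) in simp)
      then show ?thesis by simp
    next
      case False
      then have "K \<in> K5_family n"
        by (intro minimal_generating_K5[OF assms(1,3) ne a]) blast
      then show ?thesis by simp
    qed
  next
    case False
    then have no: "\<not> avoidable n K a 1" for a by simp
    consider "n \<le> 4" | "n = 5" | "n = 6" | "n = 7" using assms(2) by linarith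
    then show ?thesis
    proof cases
      case 1
      then show ?thesis using not_generates_no_single_small[OF assms(1) _ ne no] gen by simp
    next
      case 2
      then show ?thesis using not_generates_no_single_5[of K] ne no gen by simp
    next
      case 3
      have "K = K6" by (rule minimal_generating_6) (use assms(3) ne no 3 in simp_all)
      then show ?thesis using 3 by (simp add: K6_family_def obtained.start)
    next
      case 4
      have "K \<in> K6_family 7 \<union> K7_family 7"
        by (rule minimal_generating_7) (use assms(3) ne no 4 in simp_all)
      then show ?thesis using 4 by auto
    qed
  qed
qed

end
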